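(* Let $q$ be a power of $2$ and $d$ an integer with $d/2\ge4$ even. Let $V'=\mathbb{F}_{q^2}^{d/2}$ with quadratic form $$Q'(x)=\sum_{i=1}^{d/4-1}x_{2i-1}x_{2i}+x_{d/2-1}^2+a_0x_{d/2-1}x_{d/2}+a_1x_{d/2}^2,$$ where $X^2+a_0X+a_1$ is irreducible over $\mathbb{F}_{q^2}$, and let $\kappa'(x,y)=Q'(x+y)-Q'(x)-Q'(y)$. Regard $V'$ as a $d$-dimensional $\mathbb{F}_q$-space with the alternating form $\kappa=\mathrm{Tr}_{q^2/q}\circ\kappa'$ and associated symplectic polar space $W(d-1,q)$. Let $\mathcal{T}$ be an $\mathbb{F}_q^*$-invariant subset of $\mathbb{F}_{q^2}^*$ and $\mathcal{M}=\{\langle v\rangle_{\mathbb{F}_q}:\ Q'(v)\in\mathcal{T}\}$. Then $\mathcal{M}$ is a $\frac{|\mathcal{T}|}{q-1}q^{d/2-2}$-ovoid of $W(d-1,q)$ if and only if $\mathcal{T}=\{x^{-1}:\ x\in\mathcal{T}\}$.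
   Context: Points of $W(d-1,q)$ are all 1-dimensional $\mathbb{F}_q$-subspaces; generators are the maximal totally isotropic subspaces; an $m$-ovoid is a set of points meeting every generator in exactly $m$ points. *)

theory Defs
  imports
    "HOL-Computational_Algebra.Computational_Algebra"
    "HOL-Library.Function_Algebras"
    "HOL-Library.Cardinality"
begin

subsection \<open>Polar spaces of alternating forms\<close>

text \<open>
  Here \<open>scl\<close> is the scalar multiplication of a vector space, \<open>V\<close> is a subspace of it,
  and \<open>B\<close> is a bilinear form on \<open>V\<close> with values in the scalars.  In the application, \<open>B\<close> is
  alternating and nondegenerate, so that the totally isotropic subspaces of \<open>V\<close> form the
  symplectic polar space \<open>W(dim V - 1, q)\<close>.
\<close>

definition pg_points :: "('k::field \<Rightarrow> 'v::ab_group_add \<Rightarrow> 'v) \<Rightarrow> 'v set \<Rightarrow> 'v set set" where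
  "pg_points scl V = {P. module.subspace scl P \<and> P \<subseteq> V \<and> vector_space.dim scl P = 1}"

definition totally_isotropic ::
  "('k::field \<Rightarrow> 'v::ab_group_add \<Rightarrow> 'v) \<Rightarrow> 'v set \<Rightarrow> ('v \<Rightarrow> 'v \<Rightarrow> 'k) \<Rightarrow> 'v set \<Rightarrow> bool" where
  "totally_isotropic scl V B S \<longleftrightarrow>
     module.subspace scl S \<and> S \<subseteq> V \<and> (\<forall>x\<in>S. \<forall>y\<in>S. B x y = 0)"

definition generators ::
  "('k::field \<Rightarrow> 'v::ab_group_add \<Rightarrow> 'v) \<Rightarrow> 'v set \<Rightarrow> ('v \<Rightarrow> 'v \<Rightarrow> 'k) \<Rightarrow> 'v set set" where
  "generators scl V B =
     {G. totally_isotropic scl V B G \<and> (\<forall>S. totally_isotropic scl V B S \<and> G \<subseteq> S \<longrightarrow> S = G)}"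

definition is_ovoid ::
  "('k::field \<Rightarrow> 'v::ab_group_add \<Rightarrow> 'v) \<Rightarrow> 'v set \<Rightarrow> ('v \<Rightarrow> 'v \<Rightarrow> 'k) \<Rightarrow> nat \<Rightarrow> 'v set set \<Rightarrow> bool" where
  "is_ovoid scl V B m M \<longleftrightarrow>
     M \<subseteq> pg_points scl V \<and> (\<forall>G\<in>generators scl V B. card {P\<in>M. P \<subseteq> G} = m)"

subsection \<open>The quadratic field extension\<close>

text \<open>
  The fields of orders \<open>q\<close> and \<open>q\<^sup>2\<close> are two types \<open>'k\<close> and \<open>'a\<close>, and the smaller one is
  identified with its image under an embedding \<open>\<iota>\<close> (which is the unique subfield of
  order \<open>q\<close>).
\<close>

definition field_embedding :: "('k::field \<Rightarrow> 'a::field) \<Rightarrow> bool" where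
  "field_embedding \<iota> \<longleftrightarrow>
     \<iota> 1 = 1 \<and> (\<forall>x y. \<iota> (x + y) = \<iota> x + \<iota> y) \<and> (\<forall>x y. \<iota> (x * y) = \<iota> x * \<iota> y)"

text \<open>
  The relative trace \<open>z + z\<^sup>q\<close>, pulled back along \<open>\<iota>\<close>; lemma \<open>embed_rel_trace\<close> below shows
  that it does lie in the image of \<open>\<iota>\<close>.
\<close>
definition rel_trace :: "('k::finite_field \<Rightarrow> 'a::finite_field) \<Rightarrow> 'a \<Rightarrow> 'k" where
  "rel_trace \<iota> z = the_inv \<iota> (z + z ^ CARD('k))"

subsection \<open>The space \<open>V'\<close> and its forms\<close>

text \<open>
  The coordinate space of dimension \<open>d/2\<close> over \<open>'a\<close>: families indexed from \<open>1\<close> to \<open>d/2\<close>,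
  extended by zero so that the pointwise operations on functions apply.
\<close>
definition coord_space :: "nat \<Rightarrow> (nat \<Rightarrow> 'a::field) set" where
  "coord_space d = {x. \<forall>i. i \<notin> {1..d div 2} \<longrightarrow> x i = 0}"

definition restr_scale :: "('k::field \<Rightarrow> 'a::field) \<Rightarrow> 'k \<Rightarrow> (nat \<Rightarrow> 'a) \<Rightarrow> (nat \<Rightarrow> 'a)" where
  "restr_scale \<iota> c x = (\<lambda>i. \<iota> c * x i)"

definition Q' :: "nat \<Rightarrow> 'a::field \<Rightarrow> 'a \<Rightarrow> (nat \<Rightarrow> 'a) \<Rightarrow> 'a" where
  "Q' d a0 a1 x =
     (\<Sum>i=1..d div 4 - 1. x (2 * i - 1) * x (2 * i))
     + (x (d div 2 - 1))\<^sup>2 + a0 * x (d div 2 - 1) * x (d div 2) + a1 * (x (d div 2))\<^sup>2"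

definition kappa' :: "nat \<Rightarrow> 'a::field \<Rightarrow> 'a \<Rightarrow> (nat \<Rightarrow> 'a) \<Rightarrow> (nat \<Rightarrow> 'a) \<Rightarrow> 'a" where
  "kappa' d a0 a1 x y = Q' d a0 a1 (x + y) - Q' d a0 a1 x - Q' d a0 a1 y"

definition kappa ::
  "('k::finite_field \<Rightarrow> 'a::finite_field) \<Rightarrow> nat \<Rightarrow> 'a \<Rightarrow> 'a \<Rightarrow> (nat \<Rightarrow> 'a) \<Rightarrow> (nat \<Rightarrow> 'a) \<Rightarrow> 'k" where
  "kappa \<iota> d a0 a1 x y = rel_trace \<iota> (kappa' d a0 a1 x y)"

definition point_set ::
  "('k::field \<Rightarrow> 'a::field) \<Rightarrow> nat \<Rightarrow> 'a \<Rightarrow> 'a \<Rightarrow> 'a set \<Rightarrow> (nat \<Rightarrow> 'a) set set" where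
  "point_set \<iota> d a0 a1 T =
     {module.span (restr_scale \<iota>) {v} | v. v \<in> coord_space d \<and> Q' d a0 a1 v \<in> T}"

subsection \<open>Consistency of the definitions\<close>

lemma field_embedding_zero: "field_embedding \<iota> \<Longrightarrow> \<iota> 0 = 0"
  unfolding field_embedding_def by (metis add_cancel_right_right)

lemma field_embedding_eq_0:
  assumes "field_embedding \<iota>"
  shows "\<iota> x = 0 \<longleftrightarrow> x = 0"
  using assms field_embedding_zero[OF assms] unfolding field_embedding_def
  by (metis mult_zero_left right_inverse zero_neq_one)

lemma field_embedding_inj:
  assumes "field_embedding \<iota>"
  shows "inj \<iota>"
proof (rule injI)
  fix x y assume eq: "\<iota> x = \<iota> y"
  have "\<iota> x = \<iota> (x - y) + \<iota> y"
    using assms unfolding field_embedding_def by (metis diff_add_cancel)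
  then have "\<iota> (x - y) = 0" using eq by simp
  then show "x = y" using field_embedding_eq_0[OF assms] by simp
qed

lemma field_embedding_power:
  assumes "field_embedding \<iota>"
  shows "\<iota> (x ^ n) = \<iota> x ^ n"
  by (induction n) (use assms in \<open>auto simp: field_embedding_def\<close>)

lemma vector_space_restr_scale:
  assumes "field_embedding \<iota>"
  shows "vector_space (restr_scale \<iota>)"
  using assms unfolding field_embedding_def
  by unfold_locales (auto simp: restr_scale_def fun_eq_iff algebra_simps)

lemma subspace_coord_space:
  assumes "field_embedding \<iota>"
  shows "module.subspace (restr_scale \<iota>) (coord_space d)"
proof -
  interpret vector_space "restr_scale \<iota>" by (rule vector_space_restr_scale[OF assms])
  show ?thesis by (rule subspaceI) (auto simp: coord_space_def restr_scale_def)
qed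

lemma range_field_embedding:
  fixes \<iota> :: "'k::finite_field \<Rightarrow> 'a::finite_field"
  assumes "field_embedding \<iota>"
  shows "range \<iota> = {z. z ^ CARD('k) = z}"
proof -
  let ?q = "CARD('k)"
  let ?p = "monom 1 ?q - monom 1 1 :: 'a poly"
  have q: "?q > 1"
    using card_mono[of UNIV "{0, 1 :: 'k}"] by simp
  have "coeff ?p ?q = 1" using q by simp
  then have p: "?p \<noteq> 0" by (metis coeff_0 zero_neq_one)
  have set_eq: "{z. z ^ ?q = z} = {z. poly ?p z = 0}" by (simp add: poly_monom)
  have "degree ?p \<le> ?q"
    by (rule degree_diff_le) (use q in \<open>auto simp: degree_monom_eq\<close>)
  then have "card {z. poly ?p z = 0} \<le> ?q"
    using card_poly_roots_bound[OF p] by simp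
  moreover have "card (range \<iota>) = ?q"
    by (rule card_image[OF field_embedding_inj[OF assms]])
  moreover have "range \<iota> \<subseteq> {z. z ^ ?q = z}"
    by (auto simp flip: field_embedding_power[OF assms] simp: finite_field_power_card_eq_same)
  ultimately show ?thesis
    unfolding set_eq by (intro card_seteq poly_roots_finite p) simp_all
qed

lemma embed_rel_trace:
  fixes \<iota> :: "'k::finite_field \<Rightarrow> 'a::finite_field"
  assumes emb: "field_embedding \<iota>" and k: "CARD('k) = 2 ^ h" and a: "CARD('a) = CARD('k)\<^sup>2"
  shows "\<iota> (rel_trace \<iota> z) = z + z ^ CARD('k)"
proof -
  have prime: "prime CHAR('a)" by (rule prime_CHAR_semidom) simp
  have "(\<Sum>x\<in>(UNIV :: 'a set). x + 1) = (\<Sum>x\<in>UNIV. x)"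
    by (rule sum.reindex_bij_witness[of _ "\<lambda>x. x - 1" "\<lambda>x. x + 1"]) auto
  then have "of_nat CARD('a) = (0 :: 'a)" by (simp add: sum.distrib)
  then have "CHAR('a) dvd CARD('a)" using of_nat_eq_0_iff_char_dvd by blast
  then have "CHAR('a) dvd 2 ^ (h * 2)" by (simp add: a k flip: power_mult)
  then have char: "CHAR('a) = 2"
    using prime prime_dvd_power two_is_prime_nat primes_dvd_imp_eq by blast
  have "(z + z ^ CARD('k)) ^ CARD('k) = z ^ CARD('k) + (z ^ CARD('k)) ^ CARD('k)"
    by (rule freshmans_dream'[OF prime, of _ h]) (simp add: char k)
  also have "(z ^ CARD('k)) ^ CARD('k) = z"
    using finite_field_power_card_eq_same[of z] by (simp add: a power2_eq_square power_mult)
  finally have "z + z ^ CARD('k) \<in> range \<iota>"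
    by (simp add: range_field_embedding[OF emb] add.commute)
  then show ?thesis
    unfolding rel_trace_def by (rule f_the_inv_into_f[OF field_embedding_inj[OF emb]])
qed

text \<open>An invariant set is a union of cosets, so that \<open>|T| / (q - 1)\<close> is an integer.\<close>
lemma card_minus_one_dvd_card_invariant:
  fixes \<iota> :: "'k::finite_field \<Rightarrow> 'a::finite_field"
  assumes emb: "field_embedding \<iota>" and T: "T \<subseteq> - {0}"
    and inv: "\<And>c. c \<noteq> 0 \<Longrightarrow> (\<lambda>t. \<iota> c * t) ` T = T"
  shows "(CARD('k) - 1) dvd card T"
proof -
  define C where "C t = (\<lambda>c. \<iota> c * t) ` (- {0})" for t
  have mult: "\<iota> (x * y) = \<iota> x * \<iota> y" and one: "\<iota> 1 = 1" for x y
    using emb by (auto simp: field_embedding_def)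
  have C_self: "t \<in> C t" for t
    unfolding C_def by (rule image_eqI[of _ _ 1]) (auto simp: one)
  have C_sub: "C s \<subseteq> C t" if st: "s \<in> C t" for s t
  proof
    fix x assume "x \<in> C s"
    then obtain c where c: "c \<noteq> 0" "x = \<iota> c * s" by (auto simp: C_def)
    obtain e where e: "e \<noteq> 0" "s = \<iota> e * t" using st by (auto simp: C_def)
    show "x \<in> C t" unfolding C_def
      by (rule image_eqI[of _ _ "c * e"]) (use c e in \<open>auto simp: mult mult.assoc\<close>)
  qed
  have C_sym: "t \<in> C s" if st: "s \<in> C t" for s t
  proof -
    obtain e where e: "e \<noteq> 0" "s = \<iota> e * t" using st by (auto simp: C_def)
    have "\<iota> (inverse e) * s = \<iota> (inverse e * e) * t" by (simp only: e(2) mult mult.assoc)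
    also have "\<dots> = t" using e by (simp add: one)
    finally show ?thesis unfolding C_def
      by (intro image_eqI[of _ _ "inverse e"]) (use e in auto)
  qed
  have C_eq: "C s = C t" if "x \<in> C s" "x \<in> C t" for x s t
    using C_sub C_sym that by blast
  have card_C: "card (C t) = CARD('k) - 1" if "t \<noteq> 0" for t
  proof -
    have "inj_on (\<lambda>c. \<iota> c * t) (- {0})"
      using that field_embedding_inj[OF emb] by (auto intro!: inj_onI dest: injD)
    then have "card (C t) = card (- {0 :: 'k})" unfolding C_def by (rule card_image)
    then show ?thesis by (simp add: Compl_eq_Diff_UNIV card_Diff_singleton)
  qed
  have U: "\<Union> (C ` T) = T"
  proof
    show "T \<subseteq> \<Union> (C ` T)" using C_self by blast
    show "\<Union> (C ` T) \<subseteq> T" using inv unfolding C_def by blast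
  qed
  have "(CARD('k) - 1) * card (C ` T) = card (\<Union> (C ` T))"
  proof (rule card_partition)
    fix c assume "c \<in> C ` T"
    then show "card c = CARD('k) - 1" using card_C T by blast
  next
    fix c1 c2 assume "c1 \<in> C ` T" "c2 \<in> C ` T" "c1 \<noteq> c2"
    then show "c1 \<inter> c2 = {}" using C_eq by blast
  qed auto
  then show ?thesis using U by (metis dvd_triv_left)
qed

end

theory Submission
  imports Defs
begin

text \<open>
  Let \<open>n = d/2\<close>.  Since the kernel of the trace in even characteristic is the small field, the vectors
  with \<open>Q' v \<in> \<F>\<^sub>q t\<close> are the zeros of the form \<open>Tr (Q' v / t)\<close>, an elliptic quadric \<open>E\<^sub>t\<close> over the
  small field.  The hyperplane \<open>y\<^sup>\<bottom>\<close> is the polar hyperplane of \<open>t y\<close> with respect to this form, and so it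
  is tangent to \<open>E\<^sub>t\<close> exactly when \<open>y\<close> lies on the quadric of the inverse parameter \<open>1/t\<close>.  Counting pairs
  \<open>(v, y)\<close> with \<open>v \<in> E\<^sub>t\<close>, \<open>y \<in> G\<close> and \<open>v \<bottom> y\<close> for a generator \<open>G\<close> gives
  \<open>|E\<^sub>t \<inter> G| + |E\<^sub>1\<^sub>/\<^sub>t \<inter> G| = 2 q\<^sup>n\<^sup>-\<^sup>1\<close>, and summing over \<open>t \<in> T\<close> settles an inverse-closed \<open>T\<close>.

  For the converse it suffices to use the generators \<open>W + L\<close>, where \<open>W\<close> is a fixed maximal totally singular
  subspace and \<open>L\<close> is a totally isotropic line of the anisotropic plane spanned by the last two coordinates.
  Averaging over the lines \<open>L\<close> through a point \<open>p\<close> compares the membership of \<open>Q' p\<close> in \<open>T\<close> with that of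
  \<open>1 / Q' p\<close>.
\<close>

subsection \<open>Finite fields of even order\<close>

text \<open>Adding 1 permutes the field, so the sum of all elements is unchanged when 1 is added to
  each of them. Hence the order, a power of 2, vanishes in the field, and so does 2.\<close>

lemma add_self_eq_0:
  fixes x :: "'a::finite_field"
  assumes "CARD('a) = 2 ^ h"
  shows "x + x = 0"
proof -
  have "(\<Sum>x\<in>(UNIV :: 'a set). x + 1) = (\<Sum>x\<in>UNIV. x)"
    by (rule sum.reindex_bij_witness[of _ "\<lambda>x. x - 1" "\<lambda>x. x + 1"]) auto
  then have "of_nat (2 ^ h) = (0 :: 'a)" by (simp add: sum.distrib flip: assms)
  then have "(2 :: 'a) = 0" by simp
  then show ?thesis by (metis mult_2 mult_zero_left)
qed

text \<open>In characteristic 2 the two signs of a square root coincide, so squaring is injective,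
  and a finite field turns this into a bijection. Every field element therefore has a square
  root.\<close>

lemma bij_square:
  assumes "CARD('a::finite_field) = 2 ^ h"
  shows "bij (\<lambda>x::'a. x\<^sup>2)"
proof -
  have "x = y" if "x\<^sup>2 = y\<^sup>2" for x y :: 'a
  proof -
    have "x = y \<or> x = - y" using that by (simp add: power2_eq_iff)
    moreover have "- y = y" using add_self_eq_0[OF assms, of y] by (simp add: eq_neg_iff_add_eq_0)
    ultimately show ?thesis by auto
  qed
  then have "inj (\<lambda>x::'a. x\<^sup>2)" by (rule injI)
  then show ?thesis by (simp add: bij_def finite_UNIV_inj_surj)
qed

lemma sum_card_swap:
  assumes "finite A" "finite B"
  shows "(\<Sum>x\<in>A. card {y\<in>B. R x y}) = (\<Sum>y\<in>B. card {x\<in>A. R x y})"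
  by (rule sum_multicount_gen) (use assms in auto)

text \<open>Along the family \<open>u + s a\<close> the function \<open>f\<close> takes each value
  exactly once, because \<open>g\<close> is bijective, while each translation permutes
  \<open>U\<close>. Counting the pairs \<open>(u, a)\<close> with \<open>f (u + s a) = c\<close> in
  both orders gives the equation. All equidistribution statements for hyperplanes and quadrics come
  from here.\<close>

lemma card_fibre_translate:
  fixes f :: "'v::ab_group_add \<Rightarrow> 'k::{finite,ab_group_add}" and s g :: "'k \<Rightarrow> _"
  assumes U: "finite U" "\<And>a u. u \<in> U \<Longrightarrow> u + s a \<in> U"
    and f: "\<And>a u. u \<in> U \<Longrightarrow> f (u + s a) = f u + g a" and g: "bij g"
  shows "CARD('k) * card {u\<in>U. f u = c} = card U"
proof -
  have 1: "card {u\<in>U. f (u + s a) = c} = card {u\<in>U. f u = c}" for a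
  proof -
    have "(\<lambda>u. u + s a) ` U = U"
      by (rule endo_inj_surj) (use U in \<open>auto simp: inj_on_def\<close>)
    then have "(\<lambda>u. u + s a) ` {u\<in>U. f (u + s a) = c} = {u\<in>U. f u = c}" by auto
    then show ?thesis using card_image[of "\<lambda>u. u + s a" "{u\<in>U. f (u + s a) = c}"]
      by (simp add: inj_on_def)
  qed
  have 2: "card {a. f (u + s a) = c} = 1" if "u \<in> U" for u
  proof -
    have "{a. f (u + s a) = c} = {inv g (c - f u)}"
      using g that by (auto simp: f bij_def algebra_simps inv_f_f surj_f_inv_f)
    then show ?thesis by simp
  qed
  have "CARD('k) * card {u\<in>U. f u = c} = (\<Sum>a\<in>UNIV. card {u\<in>U. f (u + s a) = c})"
    by (simp add: 1)
  also have "\<dots> = (\<Sum>u\<in>U. card {a\<in>UNIV. f (u + s a) = c})"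
    by (rule sum_card_swap) (use U in auto)
  also have "\<dots> = card U" by (simp add: 2)
  finally show ?thesis .
qed

section \<open>The trace of the quadratic extension\<close>

locale quadratic_extension =
  fixes \<iota> :: "'k::finite_field \<Rightarrow> 'a::finite_field" and q h :: nat
  assumes emb: "field_embedding \<iota>"
    and card_k: "CARD('k) = q" and q_eq: "q = 2 ^ h" and card_a: "CARD('a) = q\<^sup>2"
begin

abbreviation tr :: "'a \<Rightarrow> 'k" where "tr \<equiv> rel_trace \<iota>"

lemma card_a': "CARD('a) = 2 ^ (h * 2)"
  by (simp add: card_a q_eq power_mult)

lemma q_gt_1: "q > 1"
  using card_mono[of UNIV "{0, 1 :: 'k}"] card_k by simp

lemma emb_simps [simp]:
  "\<iota> 1 = 1" "\<iota> 0 = 0" "\<iota> (x + y) = \<iota> x + \<iota> y" "\<iota> (x * y) = \<iota> x * \<iota> y" "\<iota> x = 0 \<longleftrightarrow> x = 0"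
  "\<iota> x = \<iota> y \<longleftrightarrow> x = y"
  using emb field_embedding_zero field_embedding_eq_0 field_embedding_inj[OF emb]
  by (auto simp: field_embedding_def dest: injD)

lemma emb_inverse: "\<iota> (inverse x) = inverse (\<iota> x)"
proof (cases "x = 0")
  case False
  then have "\<iota> (inverse x) * \<iota> x = 1" by (simp flip: emb_simps(4))
  then show ?thesis by (metis inverse_unique mult.commute)
qed auto

lemma emb_tr: "\<iota> (tr z) = z + z ^ q"
  using embed_rel_trace[OF emb, of h z] by (simp add: card_k card_a q_eq)

lemma tr_add: "tr (x + y) = tr x + tr y"
proof -
  have prime: "prime CHAR('a)" by (rule prime_CHAR_semidom) simp
  have "of_nat 2 = (0::'a)" using add_self_eq_0[OF card_a', of 1] by simp
  then have "CHAR('a) dvd 2" using of_nat_eq_0_iff_char_dvd by blast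
  then have char: "CHAR('a) = 2" using prime two_is_prime_nat primes_dvd_imp_eq by blast
  have "(x + y) ^ q = x ^ q + y ^ q"
    by (rule freshmans_dream'[OF prime, of _ h]) (simp add: char q_eq)
  then have "\<iota> (tr (x + y)) = \<iota> (tr x + tr y)" by (simp only: emb_tr emb_simps) simp
  then show ?thesis by (rule injD[OF field_embedding_inj[OF emb]])
qed

lemma tr_scale: "tr (\<iota> c * z) = c * tr z"
proof -
  have "\<iota> c ^ q = \<iota> c" using finite_field_power_card_eq_same[of c] by (simp flip: field_embedding_power[OF emb] add: card_k)
  then have "\<iota> (tr (\<iota> c * z)) = \<iota> (c * tr z)"
    by (simp only: emb_tr emb_simps) (simp add: algebra_simps power_mult_distrib)
  then show ?thesis by (rule injD[OF field_embedding_inj[OF emb]])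
qed

lemma tr_0 [simp]: "tr 0 = 0" using tr_scale[of 0 0] by simp

text \<open>In characteristic 2, \<open>z + z ^ q = 0\<close> means that \<open>z\<close> is fixed
  by the \<open>q\<close>-th power map, and the fixed elements form the small field.\<close>

lemma tr_eq_0_iff: "tr z = 0 \<longleftrightarrow> z \<in> range \<iota>"
proof -
  have "tr z = 0 \<longleftrightarrow> z + z ^ q = 0" by (simp flip: emb_tr)
  also have "\<dots> \<longleftrightarrow> z ^ q = z"
    using add_self_eq_0[OF card_a', of z] by (metis add_left_cancel)
  finally show ?thesis by (simp add: range_field_embedding[OF emb] card_k)
qed

text \<open>Otherwise the trace would vanish on all multiples of \<open>z\<close>, that is
  everywhere, and its kernel, the small field, would be the whole large field.\<close>

lemma tr_nontrivial:
  assumes "z \<noteq> 0"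
  shows "\<exists>c. tr (c * z) \<noteq> 0"
proof (rule ccontr)
  assume *: "\<nexists>c. tr (c * z) \<noteq> 0"
  have "x \<in> range \<iota>" for x
  proof -
    have "tr (x / z * z) = 0" using * by blast
    then show ?thesis using assms tr_eq_0_iff by simp
  qed
  then have "surj \<iota>" by auto
  then have "CARD('a) \<le> q" using card_image_le[of UNIV \<iota>] by (simp add: card_k)
  moreover have "q < q\<^sup>2" using q_gt_1 by (simp add: power2_eq_square)
  ultimately show False using card_a by simp
qed

text \<open>For nonzero \<open>s\<close>, the trace of \<open>s / t\<close> vanishes exactly when
  \<open>t\<close> lies in the coset of \<open>s\<close> modulo the multiplicative group of the
  small field. \<open>T\<close> is a union of such cosets, so it contains this coset, of size
  \<open>q - 1\<close>, or misses it.\<close>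

lemma card_invariant_tr_div:
  assumes T: "T \<subseteq> - {0}" and inv: "\<And>c. c \<noteq> 0 \<Longrightarrow> (\<lambda>t. \<iota> c * t) ` T = T"
  shows "card {t\<in>T. tr (s / t) = 0} = (if s = 0 then card T else if s \<in> T then q - 1 else 0)"
proof (cases "s = 0")
  case False
  have closed: "\<iota> c * t \<in> T" if "t \<in> T" "c \<noteq> 0" for c t using inv that by blast
  have eq: "{t\<in>T. tr (s / t) = 0} = (if s \<in> T then (\<lambda>c. \<iota> c * s) ` (- {0}) else {})"
  proof -
    have "t \<in> (\<lambda>c. \<iota> c * s) ` (- {0}) \<and> s \<in> T" if t: "t \<in> T" "tr (s / t) = 0" for t
    proof -
      obtain c where c: "s / t = \<iota> c" using t tr_eq_0_iff by auto
      have "t \<noteq> 0" using t T by auto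
      then have s: "s = \<iota> c * t" using c by (simp add: field_simps)
      then have "c \<noteq> 0" using False by auto
      then have "t = \<iota> (inverse c) * s" "inverse c \<noteq> 0" by (auto simp: s emb_inverse)
      moreover have "s \<in> T" unfolding s by (rule closed[OF t(1) \<open>c \<noteq> 0\<close>])
      ultimately show ?thesis by blast
    qed
    moreover have "tr (s / (\<iota> c * s)) = 0" if "c \<noteq> 0" for c
    proof -
      have "s / (\<iota> c * s) = \<iota> (inverse c)" using False by (simp add: emb_inverse divide_inverse)
      then show ?thesis using tr_eq_0_iff by auto
    qed
    moreover have "\<iota> c * s \<in> T" if "s \<in> T" "c \<noteq> 0" for c
      using closed that by simp
    ultimately show ?thesis
      by (intro equalityI subsetI) (auto split: if_splits)
  qed
  have "card ((\<lambda>c. \<iota> c * s) ` (- {0})) = card (- {0 :: 'k})"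
    by (rule card_image) (use False in \<open>auto intro!: inj_onI\<close>)
  also have "\<dots> = q - 1" by (simp add: Compl_eq_Diff_UNIV card_Diff_singleton card_k)
  finally show ?thesis using False by (simp add: eq)
qed simp

end

subsection \<open>Quadratic spaces over the large field\<close>

text \<open>Here \<open>n\<close> is the dimension of \<open>V\<close> over the large field. The
  elliptic type enters only through \<open>card_zeros\<close>, the number of singular vectors (zero
  included), stated additively to avoid a negative term. The locale is used for the whole space and,
  with \<open>n = 2\<close>, for the anisotropic plane.\<close>

locale quadratic_space = quadratic_extension \<iota> q h + vector_space scl
  for \<iota> :: "'k::finite_field \<Rightarrow> 'a::finite_field" and q h :: nat
    and scl :: "'a \<Rightarrow> 'v::ab_group_add \<Rightarrow> 'v" +
  fixes V :: "'v set" and Q :: "'v \<Rightarrow> 'a" and B :: "'v \<Rightarrow> 'v \<Rightarrow> 'a" and n :: nat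
  assumes finite_V: "finite V" and subspace_V: "subspace V"
    and Q_add: "Q (x + y) = Q x + Q y + B x y" and Q_scale: "Q (scl c x) = c\<^sup>2 * Q x"
    and B_add: "B (x + y) z = B x z + B y z" and B_scale: "B (scl c x) y = c * B x y"
    and nondegenerate: "y \<in> V \<Longrightarrow> y \<noteq> 0 \<Longrightarrow> \<exists>x\<in>V. B x y \<noteq> 0"
    and n_ge_2: "n \<ge> 2" and card_V: "card V = q ^ (2 * n)"
    and card_zeros: "card {v\<in>V. Q v = 0} + q ^ n = q ^ (2 * n - 2) + q ^ (n - 2)"
begin

sublocale F: vector_space "\<lambda>c. scl (\<iota> c)"
proof
  show "scl (\<iota> a) (x + y) = scl (\<iota> a) x + scl (\<iota> a) y" for a x y
    by (rule scale_right_distrib)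
  show "scl (\<iota> (a + b)) x = scl (\<iota> a) x + scl (\<iota> b) x" for a b x
    by (simp only: emb_simps scale_left_distrib)
  show "scl (\<iota> a) (scl (\<iota> b) x) = scl (\<iota> (a * b)) x" for a b x
    by (simp only: emb_simps scale_scale)
  show "scl (\<iota> 1) x = x" for x
    by (simp only: emb_simps scale_one)
qed

section \<open>The trace form and its perpendicular spaces\<close>

abbreviation \<beta> :: "'v \<Rightarrow> 'v \<Rightarrow> 'k" where "\<beta> x y \<equiv> tr (B x y)"

definition perp :: "'v set \<Rightarrow> 'v set" where
  "perp G = {v\<in>V. \<forall>y\<in>G. \<beta> v y = 0}"

lemma add_self: "x + x = 0" for x :: 'v
proof -
  have "x + x = scl (1 + 1) x" by (simp only: scale_left_distrib scale_one)
  also have "(1 :: 'a) + 1 = 0" by (rule add_self_eq_0[OF card_a'])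
  finally show ?thesis by simp
qed

lemma Q_0 [simp]: "Q 0 = 0" using Q_scale[of 0 0] by simp

lemma B_sym: "B x y = B y x"
  using Q_add[of x y] Q_add[of y x] by (simp add: add.commute)

lemma B_self [simp]: "B x x = 0"
  using Q_add[of x x] add_self[of x] add_self_eq_0[OF card_a', of "Q x"] by simp

lemma B_0 [simp]: "B 0 y = 0" "B y 0 = 0"
  using B_scale[of 0 0 y] B_sym[of y 0] by simp_all

lemma B_add_right: "B z (x + y) = B z x + B z y" and B_scale_right: "B y (scl c x) = c * B y x"
  using B_add[of x y z] B_scale[of c x y] by (metis B_sym)+

lemmas B_linear = B_add B_scale B_add_right B_scale_right

lemma F_subspace: "subspace U \<Longrightarrow> F.subspace U"
  by (auto simp: subspace_def F.subspace_def)

lemma add_mem: "F.subspace U \<Longrightarrow> x \<in> U \<Longrightarrow> y \<in> U \<Longrightarrow> x + y \<in> U"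
  and scale_mem: "F.subspace U \<Longrightarrow> x \<in> U \<Longrightarrow> scl (\<iota> c) x \<in> U"
  by (auto simp: F.subspace_def)

lemma subspace_perp: "F.subspace (perp G)"
  using F_subspace[OF subspace_V]
  by (auto simp: F.subspace_def perp_def B_linear tr_add tr_scale)

text \<open>A vector \<open>x\<close> with \<open>B x y\<close> nonzero can be rescaled over the
  large field until the trace is nonzero as well.\<close>

lemma \<beta>_nondegenerate:
  assumes "y \<in> V" "y \<noteq> 0"
  shows "\<exists>x\<in>V. \<beta> x y \<noteq> 0"
proof -
  obtain x where x: "x \<in> V" "B x y \<noteq> 0" using nondegenerate[OF assms] by blast
  then obtain c where "tr (c * B x y) \<noteq> 0" using tr_nontrivial by blast
  then show ?thesis using x subspace_V by (intro bexI[of _ "scl c x"]) (auto simp: B_scale subspace_def)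
qed

text \<open>Translation by multiples of a vector \<open>u0\<close> with nonzero value moves the
  values of the functional bijectively, so all its fibres have the same size.\<close>

lemma card_hyperplane:
  assumes U: "F.subspace U" "finite U" and w: "\<exists>u\<in>U. \<beta> u w \<noteq> 0"
  shows "q * card {u\<in>U. \<beta> u w = c} = card U"
proof -
  obtain u0 where u0: "u0 \<in> U" "\<beta> u0 w \<noteq> 0" using w by blast
  have "bij (\<lambda>a. a * \<beta> u0 w)"
    by (rule o_bij[of "\<lambda>b. b / \<beta> u0 w"]) (use u0 in \<open>auto simp: fun_eq_iff\<close>)
  then show ?thesis unfolding card_k[symmetric]
    by (intro card_fibre_translate[where s = "\<lambda>a. scl (\<iota> a) u0"])
      (use U u0 in \<open>auto simp: add_mem scale_mem B_linear tr_add tr_scale\<close>)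
qed

lemma card_perp_point:
  assumes "y \<in> V" "y \<noteq> 0"
  shows "real (card {v\<in>V. \<beta> v y = c}) = real (card V) / q"
proof -
  have "q * card {v\<in>V. \<beta> v y = c} = card V"
    by (rule card_hyperplane) (use F_subspace[OF subspace_V] finite_V \<beta>_nondegenerate assms in auto)
  then have "real q * card {v\<in>V. \<beta> v y = c} = card V" by (metis of_nat_mult)
  then show ?thesis using q_gt_1 by (simp add: field_simps)
qed

lemma card_sub_perp_point:
  assumes "F.subspace G" "G \<subseteq> V" "v \<in> V"
  shows "real (card {y\<in>G. \<beta> v y = 0}) = (if v \<in> perp G then card G else card G / q)"
proof (cases "v \<in> perp G")
  case True
  then have "{y\<in>G. \<beta> v y = 0} = G" by (auto simp: perp_def)
  then show ?thesis using True by simp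
next
  case False
  then have "\<exists>u\<in>G. \<beta> u v \<noteq> 0" using assms(3) B_sym[of v] by (auto simp: perp_def)
  then have "q * card {y\<in>G. \<beta> y v = 0} = card G"
    using assms finite_V finite_subset by (intro card_hyperplane) auto
  moreover have "{y\<in>G. \<beta> y v = 0} = {y\<in>G. \<beta> v y = 0}" by (metis B_sym)
  ultimately have "real q * card {y\<in>G. \<beta> v y = 0} = card G" by (metis of_nat_mult)
  then show ?thesis using q_gt_1 False by (simp add: field_simps)
qed

text \<open>This counts orthogonal pairs in \<open>X\<close> times \<open>G\<close> by their first
  member: a vector of \<open>perp G\<close> is orthogonal to all of \<open>G\<close>, any other to a
  hyperplane of \<open>G\<close>.\<close>

lemma sum_sub_perp_point:
  assumes "F.subspace G" "G \<subseteq> V" "X \<subseteq> V"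
  shows "(\<Sum>v\<in>X. real (card {y\<in>G. \<beta> v y = 0})) =
    card (X \<inter> perp G) * card G + (real (card X) - card (X \<inter> perp G)) * (card G / q)"
proof -
  have fin: "finite X" using assms(3) finite_V finite_subset by blast
  have "(\<Sum>v\<in>X. real (card {y\<in>G. \<beta> v y = 0})) =
      (\<Sum>v\<in>X. if v \<in> perp G then real (card G) else card G / q)"
    by (rule sum.cong[OF refl], rule card_sub_perp_point[OF assms(1,2)]) (use assms(3) in blast)
  also have "\<dots> = card (X \<inter> perp G) * card G + card (X - perp G) * (card G / q)"
    using fin by (simp add: sum.If_cases Int_def Diff_eq Compl_eq)
  also have "real (card (X - perp G)) = real (card X) - card (X \<inter> perp G)"
    using fin card_Diff_subset_Int[of X "perp G"] card_mono[of X "X \<inter> perp G"] by (simp add: of_nat_diff)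
  finally show ?thesis .
qed

text \<open>Orthogonal pairs in \<open>V\<close> times \<open>G\<close> are counted by either
  member, and the resulting equation is solved for the order of \<open>perp G\<close>.\<close>

lemma card_perp:
  assumes G: "F.subspace G" "G \<subseteq> V"
  shows "card G * card (perp G) = card V"
proof -
  have fin: "finite G" and 0: "0 \<in> G" using G finite_V finite_subset F.subspace_0 by auto
  have perp: "V \<inter> perp G = perp G" by (auto simp: perp_def)
  have "(\<Sum>v\<in>V. real (card {y\<in>G. \<beta> v y = 0})) = (\<Sum>y\<in>G. real (card {v\<in>V. \<beta> v y = 0}))"
    using sum_card_swap[OF finite_V fin, of "\<lambda>v y. \<beta> v y = 0"] by (simp flip: of_nat_sum)
  \<comment> \<open>The zero vector is orthogonal to all of \<open>V\<close>, every other vector of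
    \<open>G\<close> to a hyperplane only.\<close>
  also have "\<dots> = card V + (\<Sum>y\<in>G - {0}. real (card {v\<in>V. \<beta> v y = 0}))"
    using fin 0 by (subst sum.remove[of _ 0]) auto
  also have "(\<Sum>y\<in>G - {0}. real (card {v\<in>V. \<beta> v y = 0})) = (\<Sum>y\<in>G - {0}. card V / q)"
    by (rule sum.cong) (use G card_perp_point in auto)
  also have "\<dots> = (real (card G) - 1) * (card V / q)"
  proof -
    have "card G > 0" using fin 0 card_gt_0_iff by blast
    then show ?thesis using 0 by (simp add: card_Diff_singleton of_nat_diff)
  qed
  finally have "card (perp G) * card G + (real (card V) - card (perp G)) * (card G / q)
      = card V + (real (card G) - 1) * (card V / q)"
    unfolding sum_sub_perp_point[OF G order_refl] perp .
  then have "(real q - 1) * (real (card G) * card (perp G)) = (real q - 1) * card V"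
    using q_gt_1 by (simp add: field_simps)
  then have "real (card G * card (perp G)) = real (card V)" using q_gt_1 by simp
  then show ?thesis by (simp only: of_nat_eq_iff)
qed

lemma card_self_perp:
  assumes "F.subspace G" "G \<subseteq> V" "perp G = G"
  shows "card G = q ^ n"
proof -
  have "(card G)\<^sup>2 = (q ^ n)\<^sup>2"
    using card_perp[OF assms(1,2)] assms(3) card_V by (simp add: power2_eq_square mult_2 power_add)
  then show ?thesis by simp
qed

text \<open>This is the passage from quadrics to values in \<open>T\<close>: a singular vector is
  counted for every \<open>t\<close>, and a vector with value in \<open>T\<close> once for each
  element of a coset, hence \<open>q - 1\<close> times.\<close>

lemma sum_card_tr:
  assumes T: "T \<subseteq> - {0}" "\<And>c. c \<noteq> 0 \<Longrightarrow> (\<lambda>t. \<iota> c * t) ` T = T" and X: "finite X"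
  shows "(\<Sum>t\<in>T. card {v\<in>X. tr (Q v / t) = 0}) =
    card T * card {v\<in>X. Q v = 0} + (q - 1) * card {v\<in>X. Q v \<in> T}"
proof -
  have "(\<Sum>t\<in>T. card {v\<in>X. tr (Q v / t) = 0}) = (\<Sum>v\<in>X. card {t\<in>T. tr (Q v / t) = 0})"
    by (rule sum_card_swap) (use X in auto)
  also have "\<dots> = (\<Sum>v\<in>X. (if Q v = 0 then card T else 0) + (if Q v \<in> T then q - 1 else 0))"
    using T(1) by (intro sum.cong) (auto simp: card_invariant_tr_div[OF T])
  also have "\<dots> = card T * card {v\<in>X. Q v = 0} + (q - 1) * card {v\<in>X. Q v \<in> T}"
    using X by (simp add: sum.distrib sum.If_cases Int_def mult.commute)
  finally show ?thesis .
qed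

section \<open>The quadrics of the overview, with \<open>quadric t\<close> for the parameter
  1/t\<close>

definition quadric :: "'a \<Rightarrow> 'v set" where
  "quadric t = {v\<in>V. tr (t * Q v) = 0}"

lemma subset_finite: "X \<subseteq> V \<Longrightarrow> finite X"
  using finite_V finite_subset by blast

lemma square_root: obtains c where "c\<^sup>2 = (x :: 'a)"
  using bij_square[OF card_a'] by (metis bij_pointE)

lemma scale_V: "x \<in> V \<Longrightarrow> scl c x \<in> V"
  using subspace_V by (auto simp: subspace_def)

text \<open>Scaling by a square root of \<open>s / t\<close> multiplies \<open>Q\<close> by
  \<open>s / t\<close> and so carries one quadric onto the other.\<close>

lemma card_quadric_eq:
  assumes "s \<noteq> 0" "t \<noteq> 0"
  shows "card (quadric s) = card (quadric t)"
proof -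
  obtain c where c: "c\<^sup>2 = s / t" by (rule square_root)
  then have "c \<noteq> 0" using assms by auto
  have "bij_betw (scl c) (quadric s) (quadric t)"
  proof (rule bij_betw_byWitness[where f' = "scl (1 / c)"])
    have "t * c\<^sup>2 = s" "s * (1 / c)\<^sup>2 = t" using assms by (simp_all add: c power_divide)
    then show "scl c ` quadric s \<subseteq> quadric t" "scl (1 / c) ` quadric t \<subseteq> quadric s"
      by (auto simp only: quadric_def Q_scale scale_V mem_Collect_eq mult.assoc[symmetric])
  qed (use \<open>c \<noteq> 0\<close> in auto)
  then show ?thesis by (rule bij_betw_same_card)
qed

lemma card_nonzero: "real (card (- {0} :: 'a set)) = (real q)\<^sup>2 - 1"
  using q_gt_1 by (simp add: Compl_eq_Diff_UNIV card_Diff_singleton card_a of_nat_diff)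

lemma nonzero_invariant: "c \<noteq> 0 \<Longrightarrow> (\<lambda>t. \<iota> c * t) ` (- {0}) = - {0}"
proof -
  assume c: "c \<noteq> 0"
  have "t \<in> (\<lambda>t. \<iota> c * t) ` (- {0})" if "t \<noteq> 0" for t
    by (rule image_eqI[of _ _ "t / \<iota> c"]) (use c that in auto)
  then show ?thesis using c by auto
qed

lemma real_q: "real (q - 1) = real q - 1"
  using q_gt_1 by (simp add: of_nat_diff)

lemma card_real_V: "real (card V) = (real q ^ n)\<^sup>2"
  by (simp add: card_V power_mult power_mult_distrib mult.commute[of 2])

lemma sum_card_tr_nonzero:
  assumes "finite X"
  shows "(\<Sum>t\<in>- {0}. real (card {v\<in>X. tr (Q v / t) = 0})) =
    ((real q)\<^sup>2 - 1) * card {v\<in>X. Q v = 0} + (real q - 1) * (real (card X) - card {v\<in>X. Q v = 0})"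
proof -
  have "card {v\<in>X. Q v \<in> - {0}} = card (X - {v\<in>X. Q v = 0})"
    by (rule arg_cong[of _ _ card]) auto
  also have "real \<dots> = real (card X) - card {v\<in>X. Q v = 0}"
    using assms by (subst card_Diff_subset) (auto intro!: of_nat_diff card_mono)
  finally have *: "real (card {v\<in>X. Q v \<in> - {0}}) = real (card X) - card {v\<in>X. Q v = 0}" .
  have "(\<Sum>t\<in>- {0}. real (card {v\<in>X. tr (Q v / t) = 0})) =
      real (card (- {0 :: 'a}) * card {v\<in>X. Q v = 0} + (q - 1) * card {v\<in>X. Q v \<in> - {0}})"
    using sum_card_tr[OF order_refl nonzero_invariant assms] by (simp flip: of_nat_sum)
  then show ?thesis unfolding of_nat_add of_nat_mult * card_nonzero real_q .
qed

text \<open>Since all quadrics have the same size, it suffices to know their total. The total over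
  all nonzero parameters follows from the number of zeros of \<open>Q\<close>. The result is the
  number of singular vectors of an elliptic form in \<open>2 * n\<close> variables over the small
  field.\<close>

lemma card_quadric:
  assumes "t \<noteq> 0"
  shows "real (card (quadric t)) = (real q ^ n)\<^sup>2 / q - (real q - 1) * real q ^ n / q"
proof -
  define r g where "r = real q" and "g = r ^ n"
  define N a where "N = real (card (quadric t))" and "a = real (card {v\<in>V. Q v = 0})"
  have r: "r > 1" using q_gt_1 by (simp add: r_def)
  have "real (card {v\<in>V. tr (Q v / s) = 0}) = N" if "s \<in> - {0}" for s
    using card_quadric_eq[of "1 / s" t] that assms by (simp add: quadric_def N_def)
  then have "(\<Sum>s\<in>- {0}. real (card {v\<in>V. tr (Q v / s) = 0})) = (r\<^sup>2 - 1) * N"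
    by (simp add: card_nonzero r_def)
  then have 1: "(r\<^sup>2 - 1) * N = (r\<^sup>2 - 1) * a + (r - 1) * (g\<^sup>2 - a)"
    using sum_card_tr_nonzero[OF finite_V] by (simp add: card_real_V r_def g_def a_def)
  have "a + g = g\<^sup>2 / r\<^sup>2 + g / r\<^sup>2"
  proof -
    have "a + g = r ^ (2 * n - 2) + r ^ (n - 2)"
      using card_zeros unfolding a_def g_def r_def by (metis of_nat_add of_nat_power)
    also have "\<dots> = g\<^sup>2 / r\<^sup>2 + g / r\<^sup>2"
      using n_ge_2 r by (simp add: g_def power_diff power_mult power2_eq_square flip: power_add mult_2)
    finally show ?thesis .
  qed
  then have a: "a = g\<^sup>2 / r\<^sup>2 + g / r\<^sup>2 - g" by simp
  have "(r - 1) * ((r + 1) * N) = (r - 1) * (r * a + g\<^sup>2)"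
    using 1 by (simp add: algebra_simps power2_eq_square)
  then have "(r + 1) * N = r * a + g\<^sup>2" using r by simp
  also have "\<dots> = (r + 1) * (g\<^sup>2 / r - (r - 1) * g / r)"
    using r by (simp add: a field_simps power2_eq_square)
  finally have "N = g\<^sup>2 / r - (r - 1) * g / r" using r by simp
  then show ?thesis by (simp add: N_def r_def g_def)
qed

text \<open>The space is cut into the slices where \<open>\<beta> v y\<close> is constant, and
  translations by multiples of the pole \<open>w\<close> of the hyperplane act on each slice. If
  \<open>w\<close> is not on the quadric, the slice through zero is equidistributed. If it is, all
  other slices are, and the slice through zero gets the remainder.\<close>

lemma card_quadric_perp_point:
  assumes t: "t \<noteq> 0" and y: "y \<in> V" "y \<noteq> 0"
  shows "real (card {v\<in>quadric t. \<beta> v y = 0}) =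
    (if tr (Q y / t) = 0 then card (quadric t) - (real q - 1) * card V / (real q)\<^sup>2
     else card V / (real q)\<^sup>2)"
proof -
  \<comment> \<open>The factor \<open>1 / t\<close> cancels the \<open>t\<close> in
    \<open>f\<close>, so that the polar form of \<open>f\<close> at \<open>w\<close> is
    \<open>\<beta> v y\<close>.\<close>
  define w where "w = scl (1 / t) y"
  define f where "f v = tr (t * Q v)" for v
  define U where "U c = {v\<in>V. \<beta> v y = c}" for c
  have w: "w \<in> V" using y by (simp add: w_def scale_V)
  have fw: "f w = tr (Q y / t)" using t by (simp add: f_def w_def Q_scale power2_eq_square)
  \<comment> \<open>Hence translation by multiples of \<open>w\<close> preserves every
    slice.\<close>
  have \<beta>w: "\<beta> w y = 0" by (simp add: w_def B_scale)
  have f_add: "f (v + scl (\<iota> a) w) = f v + (a\<^sup>2 * f w + a * \<beta> v y)" for a v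
  proof -
    have "t * Q (v + scl (\<iota> a) w) = t * Q v + (\<iota> (a\<^sup>2) * (t * Q w) + \<iota> a * B v y)"
      using t by (simp add: Q_add Q_scale B_linear w_def power2_eq_square algebra_simps)
    then show ?thesis by (simp only: f_def tr_add tr_scale)
  qed
  have U_closed: "v + scl (\<iota> a) w \<in> U c" if "v \<in> U c" for v a c
    using that w subspace_V \<beta>w by (auto simp: U_def subspace_def B_linear tr_add tr_scale)
  have finU: "finite (U c)" for c using finite_V by (simp add: U_def)
  have cardU: "real (card (U c)) = card V / q" for c
    unfolding U_def by (rule card_perp_point[OF y])
  have eq: "{v\<in>quadric t. \<beta> v y = c} = {v\<in>U c. f v = 0}" for c
    by (auto simp: quadric_def U_def f_def)
  have uniform: "real (card {v\<in>quadric t. \<beta> v y = c}) = card V / (real q)\<^sup>2"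
    if "bij (\<lambda>a. a\<^sup>2 * f w + a * c)" for c
  proof -
    have "CARD('k) * card {v\<in>U c. f v = 0} = card (U c)"
      by (rule card_fibre_translate[where s = "\<lambda>a. scl (\<iota> a) w" and g = "\<lambda>a. a\<^sup>2 * f w + a * c"])
        (use finU U_closed f_add that in \<open>auto simp: U_def\<close>)
    then have "real q * card {v\<in>U c. f v = 0} = card V / q"
      using cardU[of c] by (metis card_k of_nat_mult)
    then show ?thesis unfolding eq using q_gt_1 by (simp add: field_simps power2_eq_square)
  qed
  have bij_mult: "bij (\<lambda>a. a * c)" if "c \<noteq> 0" for c :: 'k
    by (rule o_bij[of "\<lambda>b. b / c"]) (use that in \<open>auto simp: fun_eq_iff\<close>)
  show ?thesis
  proof (cases "tr (Q y / t) = 0")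
    case False
    \<comment> \<open>On the slice \<open>c = 0\<close> only the quadratic term survives, and
      squaring is bijective on the small field.\<close>
    have "bij (\<lambda>a. a\<^sup>2 * f w + a * 0)"
      using bij_comp[OF bij_square bij_mult, of h "f w"] False
      by (simp add: fw card_k q_eq o_def)
    then show ?thesis using uniform False by simp
  next
    case True
    \<comment> \<open>The total size is known from \<open>card_quadric\<close>, and with
      \<open>f w = 0\<close> the linear term makes each slice with nonzero \<open>c\<close>
      equidistributed; subtraction leaves the slice through zero.\<close>
    have "card (quadric t) = (\<Sum>v\<in>quadric t. card {c. \<beta> v y = c})" by simp
    also have "\<dots> = (\<Sum>c\<in>UNIV. card {v\<in>quadric t. \<beta> v y = c})"
      using sum_card_swap[of "quadric t" UNIV "\<lambda>v c. \<beta> v y = c"] finite_V by (simp add: quadric_def)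
    also have "real \<dots> = real (card {v\<in>quadric t. \<beta> v y = 0})
        + (\<Sum>c\<in>UNIV - {0}. real (card {v\<in>quadric t. \<beta> v y = c}))"
      by (simp add: sum.remove[of UNIV 0])
    also have "(\<Sum>c\<in>UNIV - {0}. real (card {v\<in>quadric t. \<beta> v y = c})) =
        (\<Sum>c\<in>UNIV - {0 :: 'k}. card V / (real q)\<^sup>2)"
      by (rule sum.cong[OF refl uniform]) (use True bij_mult in \<open>auto simp: fw\<close>)
    also have "\<dots> = (real q - 1) * card V / (real q)\<^sup>2"
      using q_gt_1 by (simp add: card_Diff_singleton card_k of_nat_diff)
    finally show ?thesis using True by simp
  qed
qed

text \<open>Orthogonal pairs in \<open>quadric t\<close> times \<open>G\<close> are counted by
  either member. Counted by \<open>v\<close>, only membership in \<open>perp G = G\<close> matters.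
  Counted by \<open>y\<close>, the hyperplane section depends on whether \<open>y\<close> lies in
  \<open>quadric (1 / t)\<close>, and this is how the inverse parameter enters.\<close>

lemma card_quadric_self_perp:
  assumes G: "F.subspace G" "G \<subseteq> V" "perp G = G" and t: "t \<noteq> 0"
  shows "real (card (quadric t \<inter> G)) + card (quadric (1 / t) \<inter> G) = 2 * real q ^ n / q"
proof -
  define r g where "r = real q" and "g = r ^ n"
  define N e e' where "N = real (card (quadric t))" and "e = real (card (quadric t \<inter> G))"
    and "e' = real (card (quadric (1 / t) \<inter> G))"
  have r: "r > 1" using q_gt_1 by (simp add: r_def)
  then have g: "g > 0" by (simp add: g_def)
  have finG: "finite G" and 0: "0 \<in> G" using G subset_finite F.subspace_0 by auto
  have finq: "finite (quadric t)" using finite_V by (simp add: quadric_def)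
  have cG: "real (card G) = g" using card_self_perp[OF G] by (simp add: g_def r_def)
  have cV: "real (card V) = g\<^sup>2" by (simp add: card_real_V g_def r_def)
  have N: "N = g\<^sup>2 / r - (r - 1) * g / r"
    using card_quadric[OF t] by (simp add: N_def g_def r_def)
  define c1 c2 where "c1 = N - (r - 1) * g\<^sup>2 / r\<^sup>2" and "c2 = g\<^sup>2 / r\<^sup>2"
  have "e * g + (N - e) * (g / r) = (\<Sum>v\<in>quadric t. real (card {y\<in>G. \<beta> v y = 0}))"
    by (subst sum_sub_perp_point[OF G(1,2)]) (auto simp: quadric_def G(3) e_def N_def cG r_def)
  also have "\<dots> = (\<Sum>y\<in>G. real (card {v\<in>quadric t. \<beta> v y = 0}))"
    using sum_card_swap[OF finq finG, of "\<lambda>v y. \<beta> v y = 0"] by (simp flip: of_nat_sum)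
  also have "\<dots> = N + (\<Sum>y\<in>G - {0}. real (card {v\<in>quadric t. \<beta> v y = 0}))"
    using finG 0 by (subst sum.remove[of _ 0]) (auto simp: N_def)
  also have "(\<Sum>y\<in>G - {0}. real (card {v\<in>quadric t. \<beta> v y = 0})) =
      (\<Sum>y\<in>G - {0}. if y \<in> quadric (1 / t) then c1 else c2)"
    by (rule sum.cong[OF refl], subst card_quadric_perp_point[OF t])
      (use G in \<open>auto simp: quadric_def c1_def c2_def N_def cV r_def\<close>)
  \<comment> \<open>Zero lies in \<open>quadric (1 / t)\<close>, so completing the sum to all of
    \<open>G\<close> adds one term \<open>c1\<close>.\<close>
  also have "\<dots> = (\<Sum>y\<in>G. if y \<in> quadric (1 / t) then c1 else c2) - c1"
    using finG 0 G by (subst sum_diff1) (auto simp: quadric_def)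
  also have "(\<Sum>y\<in>G. if y \<in> quadric (1 / t) then c1 else c2) =
      card (G \<inter> quadric (1 / t)) * c1 + card (G - quadric (1 / t)) * c2"
    using finG by (simp add: sum.If_cases Int_def Diff_eq Compl_eq)
  also have "real (card (G - quadric (1 / t))) = g - e'"
    using finG by (simp add: card_Diff_subset_Int of_nat_diff card_mono cG e'_def Int_commute)
  also have "card (G \<inter> quadric (1 / t)) = card (quadric (1 / t) \<inter> G)" by (simp add: Int_commute)
  finally have "e * g + (N - e) * (g / r) = N + (e' * c1 + (g - e') * c2 - c1)"
    by (simp add: e'_def)
  \<comment> \<open>With this unit all quantities become polynomials in \<open>r\<close> and
    \<open>k\<close>, and \<open>c2 - c1\<close> is the factor \<open>(r - 1) * k\<close> cancelled
    below.\<close>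
  moreover define k where "k = g / r"
  have "g / r = k" "g = r * k" "N = r * k\<^sup>2 - (r - 1) * k"
      "c1 = k\<^sup>2 - (r - 1) * k" "c2 = k\<^sup>2"
    using r by (auto simp: k_def c1_def c2_def N field_simps power2_eq_square)
  ultimately have "(e + e') * ((r - 1) * k) = 2 * k * ((r - 1) * k)"
    by (simp add: algebra_simps power2_eq_square)
  moreover have "(r - 1) * k \<noteq> 0" using r g by (simp add: k_def)
  ultimately have "e + e' = 2 * k" by (metis mult_right_cancel)
  then have "e + e' = 2 * g / r" by (simp add: k_def)
  then show ?thesis by (simp add: e_def e'_def g_def r_def)
qed

text \<open>The contributions of \<open>t\<close> and its inverse have a constant sum, so over an
  inverse-closed \<open>T\<close> the average contribution is half of it.\<close>

lemma sum_card_self_perp: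
  assumes G: "F.subspace G" "G \<subseteq> V" "perp G = G" and T: "T \<subseteq> - {0}" "inverse ` T = T"
  shows "(\<Sum>t\<in>T. real (card {v\<in>G. tr (Q v / t) = 0})) = card T * (real q ^ n / q)"
proof -
  define e where "e t = real (card {v\<in>G. tr (Q v / t) = 0})" for t
  have e: "e t + e (inverse t) = 2 * (real q ^ n / q)" if "t \<in> T" for t
  proof -
    have "quadric s \<inter> G = {v\<in>G. tr (Q v / (1 / s)) = 0}" for s
      using G by (auto simp: quadric_def mult.commute)
    moreover have "t \<noteq> 0" using that T(1) by auto
    ultimately show ?thesis using card_quadric_self_perp[OF G, of t]
      by (simp add: e_def inverse_eq_divide add.commute)
  qed
  have "2 * (\<Sum>t\<in>T. e t) = (\<Sum>t\<in>T. e t) + (\<Sum>t\<in>inverse ` T. e t)" by (simp add: T(2))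
  also have "(\<Sum>t\<in>inverse ` T. e t) = (\<Sum>t\<in>T. e (inverse t))"
    by (subst sum.reindex) (auto simp: inj_on_def)
  also have "(\<Sum>t\<in>T. e t) + (\<Sum>t\<in>T. e (inverse t)) = (\<Sum>t\<in>T. 2 * (real q ^ n / q))"
    unfolding sum.distrib[symmetric] by (rule sum.cong[OF refl e])
  finally show ?thesis using q_gt_1 by (simp add: e_def field_simps)
qed

text \<open>The sum formula is used twice: for all nonzero parameters, which determines the number
  \<open>z\<close> of singular vectors in \<open>G\<close>, and then for \<open>T\<close>, where the
  contribution of these vectors can now be removed.\<close>

lemma card_self_perp_preimage:
  assumes G: "F.subspace G" "G \<subseteq> V" "perp G = G"
    and T: "T \<subseteq> - {0}" "\<And>c. c \<noteq> 0 \<Longrightarrow> (\<lambda>t. \<iota> c * t) ` T = T" "inverse ` T = T"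
  shows "card {v\<in>G. Q v \<in> T} = card T * q ^ (n - 2)"
proof -
  define r g z D where "r = real q" and "g = r ^ n" and "z = real (card {v\<in>G. Q v = 0})"
    and "D = real (card {v\<in>G. Q v \<in> T})"
  have r: "r > 1" using q_gt_1 by (simp add: r_def)
  have finG: "finite G" using G subset_finite by blast
  have cG: "real (card G) = g" using card_self_perp[OF G] by (simp add: g_def r_def)
  have "t \<in> inverse ` (- {0})" if "t \<noteq> 0" for t :: 'a
    by (rule image_eqI[of _ _ "inverse t"]) (use that in auto)
  then have "inverse ` (- {0 :: 'a}) = - {0}" by auto
  from sum_card_self_perp[OF G order_refl this]
  have "(r\<^sup>2 - 1) * z + (r - 1) * (g - z) = (r\<^sup>2 - 1) * (g / r)"
    unfolding sum_card_tr_nonzero[OF finG] cG card_nonzero real_q by (simp add: r_def z_def g_def)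
  then have "(r - 1) * (r\<^sup>2 * z) = (r - 1) * g"
    using r by (simp add: field_simps power2_eq_square)
  then have "r\<^sup>2 * z = g" using r by simp
  then have z: "z = g / r\<^sup>2" using r by (simp add: field_simps)
  have "real (card T * card {v\<in>G. Q v = 0} + (q - 1) * card {v\<in>G. Q v \<in> T}) = card T * (g / r)"
    using sum_card_self_perp[OF G T(1,3)] sum_card_tr[OF T(1,2) finG]
    by (simp add: g_def r_def flip: of_nat_sum)
  then have "card T * z + (r - 1) * D = card T * (g / r)"
    by (simp only: of_nat_add of_nat_mult z_def D_def r_def real_q)
  moreover have "g / r = r * (g / r\<^sup>2)" using r by (simp add: power2_eq_square)
  ultimately have "(r - 1) * D = (r - 1) * (card T * (g / r\<^sup>2))"
    unfolding z by (simp only:) (simp only: algebra_simps)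
  then have "D = card T * (g / r\<^sup>2)"
    using r unfolding mult_cancel_left by simp
  also have "g / r\<^sup>2 = r ^ (n - 2)" using r n_ge_2 by (simp add: g_def power_diff)
  finally have "real (card {v\<in>G. Q v \<in> T}) = real (card T * q ^ (n - 2))"
    by (simp add: D_def r_def)
  then show ?thesis by (simp only: of_nat_eq_iff)
qed

subsection \<open>Anisotropic planes\<close>

text \<open>For \<open>n = 2\<close> the count \<open>card_zeros\<close> leaves a single zero of
  \<open>Q\<close>, which must be the zero vector.\<close>

lemma anisotropic:
  assumes "n = 2" "v \<in> V" "Q v = 0"
  shows "v = 0"
proof -
  have "card {v\<in>V. Q v = 0} = 1" using card_zeros assms(1) by simp
  then obtain w where "{v\<in>V. Q v = 0} = {w}" by (rule card_1_singletonE)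
  moreover have "0 \<in> {v\<in>V. Q v = 0}" using subspace_V by (simp add: subspace_def)
  ultimately show ?thesis using assms(2,3) by auto
qed

lemma represents:
  assumes "n = 2"
  obtains p where "p \<in> V" "Q p = u"
proof -
  have "\<exists>v\<in>V. v \<noteq> 0"
  proof (rule ccontr)
    assume "\<not> ?thesis"
    then have "card V \<le> card {0 :: 'v}" by (intro card_mono) auto
    then show False using card_V one_less_power[OF q_gt_1, of 4] assms by simp
  qed
  then obtain v where v: "v \<in> V" "Q v \<noteq> 0" using anisotropic[OF assms] by blast
  obtain c where "c\<^sup>2 = u / Q v" by (rule square_root)
  then have "Q (scl c v) = u" using v by (simp add: Q_scale)
  then show thesis using that scale_V v by blast
qed

text \<open>The hyperplane \<open>H\<close> meets the quadric of parameter \<open>t\<close> in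
  \<open>q\<close> vectors if \<open>t * Q p\<close> lies in the small field and in
  \<open>q\<^sup>2\<close> vectors otherwise. The exceptional \<open>t\<close> form the coset of the
  inverse of \<open>Q p\<close>, so the sum over \<open>T\<close> detects whether that inverse
  belongs to \<open>T\<close>.\<close>

lemma card_perp_point_preimage:
  assumes n: "n = 2" and T: "T \<subseteq> - {0}" "\<And>c. c \<noteq> 0 \<Longrightarrow> (\<lambda>t. \<iota> c * t) ` T = T"
    and p: "p \<in> V" "p \<noteq> 0"
  shows "real (card {v\<in>V. \<beta> v p = 0 \<and> Q v \<in> T}) =
    (real q + 1) * card T - (if inverse (Q p) \<in> T then real q * (real q - 1) else 0)"
proof -
  define r where "r = real q"
  define H D where "H = {v\<in>V. \<beta> v p = 0}" and "D = real (card {v\<in>H. Q v \<in> T})"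
  define u where "u = Q p"
  have r: "r > 1" using q_gt_1 by (simp add: r_def)
  have u: "u \<noteq> 0" using anisotropic[OF n] p by (auto simp: u_def)
  have finH: "finite H" using finite_V by (simp add: H_def)
  have "{v\<in>H. Q v = 0} = {0}"
    using anisotropic[OF n] subspace_V by (auto simp: H_def subspace_def)
  then have H0: "card {v\<in>H. Q v = 0} = 1" by simp
  \<comment> \<open>The small field is closed under inversion. This brings the condition into the
    form that \<open>card_invariant_tr_div\<close> handles.\<close>
  have tr_iff: "tr (t * u) = 0 \<longleftrightarrow> tr (inverse u / t) = 0" for t
  proof -
    have "x \<in> range \<iota> \<Longrightarrow> inverse x \<in> range \<iota>" for x by (auto simp flip: emb_inverse)
    then have "t * u \<in> range \<iota> \<longleftrightarrow> inverse (t * u) \<in> range \<iota>" by (metis inverse_inverse_eq)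
    then show ?thesis unfolding tr_eq_0_iff by (simp add: divide_inverse mult.commute)
  qed
  have card_t: "real (card {v\<in>H. tr (Q v / t) = 0}) = (if tr (t * u) = 0 then r else r\<^sup>2)"
    if "t \<noteq> 0" for t
  proof -
    have "{v\<in>H. tr (Q v / t) = 0} = {v\<in>quadric (1 / t). \<beta> v p = 0}"
      by (auto simp: H_def quadric_def)
    moreover have "real (card (quadric (1 / t))) = r ^ 3 - (r - 1) * r"
      using card_quadric[of "1 / t"] that r
      by (simp add: n r_def power2_eq_square power3_eq_cube)
    moreover have "real (card V) / (real q)\<^sup>2 = r\<^sup>2" "(real q - 1) * real (card V) / (real q)\<^sup>2 = (r - 1) * r\<^sup>2"
      using r by (simp_all add: card_real_V n r_def power2_eq_square)
    ultimately show ?thesis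
      using card_quadric_perp_point[of "1 / t", OF _ p] that r
      by (simp add: u_def mult.commute algebra_simps power2_eq_square power3_eq_cube)
  qed
  have "card T * real 1 + (r - 1) * D = real (card T * card {v\<in>H. Q v = 0} + (q - 1) * card {v\<in>H. Q v \<in> T})"
    by (simp only: H0 of_nat_add of_nat_mult D_def r_def real_q)
  also have "\<dots> = (\<Sum>t\<in>T. real (card {v\<in>H. tr (Q v / t) = 0}))"
    using sum_card_tr[OF T finH] by (simp flip: of_nat_sum)
  also have "\<dots> = (\<Sum>t\<in>T. r\<^sup>2 - (if tr (inverse u / t) = 0 then r\<^sup>2 - r else 0))"
    using T(1) by (intro sum.cong[OF refl], subst card_t) (auto simp: tr_iff)
  also have "\<dots> = card T * r\<^sup>2 - (r\<^sup>2 - r) * card {t\<in>T. tr (inverse u / t) = 0}"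
    by (simp add: sum_subtractf sum.If_cases Int_def)
  also have "real (card {t\<in>T. tr (inverse u / t) = 0}) = (if inverse u \<in> T then r - 1 else 0)"
    using u card_invariant_tr_div[OF T, of "inverse u"] real_q by (simp add: r_def)
  finally have "(r - 1) * D = (r - 1) * ((r + 1) * card T - (if inverse u \<in> T then r * (r - 1) else 0))"
    by (auto simp: algebra_simps power2_eq_square)
  then have "D = (r + 1) * card T - (if inverse u \<in> T then r * (r - 1) else 0)" using r by simp
  then show ?thesis by (simp add: D_def H_def r_def u_def conj_ac)
qed

definition line :: "'v \<Rightarrow> 'v \<Rightarrow> 'v set" where
  "line x y = (\<lambda>(a, b). scl (\<iota> a) x + scl (\<iota> b) y) ` UNIV"

definition ray :: "'v \<Rightarrow> 'v set" where
  "ray x = (\<lambda>a. scl (\<iota> a) x) ` UNIV"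

lemma subspace_line: "F.subspace (line x y)"
proof (rule F.subspaceI)
  show "0 \<in> line x y" by (auto simp: line_def image_iff intro!: exI[of _ 0])
  show "u + v \<in> line x y" if uv: "u \<in> line x y" "v \<in> line x y" for u v
  proof -
    obtain a b a' b' where "u = scl (\<iota> a) x + scl (\<iota> b) y" "v = scl (\<iota> a') x + scl (\<iota> b') y"
      using uv by (auto simp: line_def)
    then have "u + v = scl (\<iota> (a + a')) x + scl (\<iota> (b + b')) y"
      by (simp add: F.scale_left_distrib del: emb_simps)
    then show ?thesis by (auto simp: line_def simp del: emb_simps)
  qed
  show "scl (\<iota> c) u \<in> line x y" if u: "u \<in> line x y" for c u
  proof -
    obtain a b where "u = scl (\<iota> a) x + scl (\<iota> b) y" using u by (auto simp: line_def)
    then have "scl (\<iota> c) u = scl (\<iota> (c * a)) x + scl (\<iota> (c * b)) y"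
      by (simp add: scale_right_distrib)
    then show ?thesis by (auto simp: line_def simp del: emb_simps)
  qed
qed

lemma mem_lineI: "scl (\<iota> a) x + scl (\<iota> b) y \<in> line x y"
  by (auto simp: line_def)

lemma mem_line: "x \<in> line x y" "y \<in> line x y"
  using mem_lineI[of 1 x 0 y] mem_lineI[of 0 x 1 y] by simp_all

lemma line_subset: "F.subspace U \<Longrightarrow> x \<in> U \<Longrightarrow> y \<in> U \<Longrightarrow> line x y \<subseteq> U"
  by (auto simp: line_def intro!: add_mem scale_mem)

lemma ray_subset_line: "ray x \<subseteq> line x y"
  by (auto simp: ray_def intro!: scale_mem subspace_line mem_line)

lemma line_isotropic:
  assumes "\<beta> x y = 0" "u \<in> line x y" "v \<in> line x y"
  shows "\<beta> u v = 0"
proof -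
  have "\<beta> y x = 0" using assms(1) B_sym by metis
  then show ?thesis using assms by (auto simp: line_def B_linear tr_add tr_scale)
qed

lemma card_ray: "x \<noteq> 0 \<Longrightarrow> card (ray x) = q"
  unfolding ray_def card_k[symmetric] by (rule card_image) (auto simp: inj_on_def)

lemma card_line:
  assumes x: "x \<noteq> 0" and y: "y \<notin> ray x"
  shows "card (line x y) = q\<^sup>2"
proof -
  have "inj (\<lambda>(a, b). scl (\<iota> a) x + scl (\<iota> b) y)"
  proof (rule injI, clarify)
    fix a b a' b'
    assume eq: "scl (\<iota> a) x + scl (\<iota> b) y = scl (\<iota> a') x + scl (\<iota> b') y"
    then have eq': "scl (\<iota> (b - b')) y = scl (\<iota> (a' - a)) x"
      by (simp add: F.scale_left_diff_distrib algebra_simps del: emb_simps)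
    have "b = b'"
    proof (rule ccontr)
      assume "b \<noteq> b'"
      then have "y = scl (\<iota> (inverse (b - b'))) (scl (\<iota> (b - b')) y)"
        by (simp add: F.scale_scale del: emb_simps scale_scale)
      also have "\<dots> = scl (\<iota> (inverse (b - b') * (a' - a))) x"
        unfolding eq' by (rule F.scale_scale)
      finally have "y \<in> ray x" unfolding ray_def by (rule range_eqI)
      then show False using y by simp
    qed
    then show "a = a' \<and> b = b'" using eq x by simp
  qed
  then have "card (line x y) = CARD('k \<times> 'k)" unfolding line_def by (rule card_image)
  then show ?thesis by (simp add: card_k power2_eq_square)
qed

lemma line_exchange:
  assumes "v \<in> line x y" "v \<notin> ray x"
  shows "y \<in> line x v"
proof -
  obtain a b where v: "v = scl (\<iota> a) x + scl (\<iota> b) y" using assms(1) by (auto simp: line_def)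
  have "b \<noteq> 0" using assms(2) v by (auto simp: ray_def)
  have "scl (\<iota> b) y = scl (\<iota> (- a)) x + scl (\<iota> 1) v"
    by (simp add: v F.scale_minus_left del: emb_simps)
  then have "scl (\<iota> b) y \<in> line x v" by (simp only: mem_lineI)
  then have "scl (\<iota> (inverse b)) (scl (\<iota> b) y) \<in> line x v" by (rule scale_mem[OF subspace_line])
  then show ?thesis using \<open>b \<noteq> 0\<close> by (simp add: F.scale_scale del: emb_simps(4) scale_scale)
qed

text \<open>For a point \<open>p\<close> with value \<open>u\<close>, the pairs
  \<open>(v, y)\<close> with \<open>v\<close> in \<open>D\<close> on the isotropic line through
  \<open>p\<close> and \<open>y\<close> are counted in both orders. The size of \<open>D\<close>
  depends on whether the inverse of \<open>u\<close> is in \<open>T\<close>, and only membership is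
  compatible with the constant intersection of lines.\<close>

lemma plane_preimage_inverse_closed:
  assumes n: "n = 2" and T: "T \<subseteq> - {0}" "\<And>c. c \<noteq> 0 \<Longrightarrow> (\<lambda>t. \<iota> c * t) ` T = T"
    and L: "\<And>L. F.subspace L \<Longrightarrow> L \<subseteq> V \<Longrightarrow> card L = q\<^sup>2 \<Longrightarrow> (\<forall>x\<in>L. \<forall>y\<in>L. \<beta> x y = 0) \<Longrightarrow>
      card {v\<in>L. Q v \<in> T} = card T"
    and u: "u \<in> T"
  shows "inverse u \<in> T"
proof (rule ccontr)
  assume contr: "inverse u \<notin> T"
  define r where "r = real q"
  have r: "r > 1" using q_gt_1 by (simp add: r_def)
  obtain p where p: "p \<in> V" "Q p = u" by (rule represents[OF n])
  then have p0: "p \<noteq> 0" using T(1) u by auto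
  define H where "H = perp {p}"
  define X where "X = H - ray p"
  define D where "D = {v\<in>H. Q v \<in> T}"
  have H: "F.subspace H" unfolding H_def by (rule subspace_perp)
  have HB: "\<beta> v p = 0" if "v \<in> H" for v using that by (auto simp: H_def perp_def)
  have HV: "H \<subseteq> V" by (auto simp: H_def perp_def)
  have pH: "p \<in> H" using p by (auto simp: H_def perp_def)
  have fin: "finite X" "finite D" "finite H" using subset_finite[OF HV] by (auto simp: X_def D_def)
  have rayH: "ray p \<subseteq> H" using H pH by (auto simp: ray_def intro: scale_mem)
  have cH: "real (card H) = r ^ 3"
    using card_perp_point[OF p(1) p0, of 0] r
    by (simp add: H_def perp_def card_real_V n r_def power2_eq_square power3_eq_cube)
  have cX: "real (card X) = r ^ 3 - r"
    using rayH fin card_mono[OF fin(3) rayH] card_ray[OF p0]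
    by (simp add: X_def card_Diff_subset finite_subset of_nat_diff cH r_def)
  have lineH: "line p y \<subseteq> H" if "y \<in> X" for y
    by (rule line_subset[OF H pH]) (use that in \<open>simp add: X_def\<close>)
  have lines: "real (card {v\<in>D. v \<in> line p y}) = card T" if "y \<in> X" for y
  proof -
    have "{v\<in>D. v \<in> line p y} = {v\<in>line p y. Q v \<in> T}" using lineH[OF that] by (auto simp: D_def)
    moreover have "card {v\<in>line p y. Q v \<in> T} = card T"
    proof (rule L[OF subspace_line])
      show "line p y \<subseteq> V" using lineH[OF that] HV by blast
      show "card (line p y) = q\<^sup>2" using that p0 by (intro card_line) (auto simp: X_def)
      have "\<beta> p y = 0" using that HB B_sym by (metis DiffD1 X_def)
      then show "\<forall>u\<in>line p y. \<forall>v\<in>line p y. \<beta> u v = 0" using line_isotropic by blast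
    qed
    ultimately show ?thesis by simp
  qed
  \<comment> \<open>A vector on the ray of \<open>p\<close> is on every line through
    \<open>p\<close>. Off the ray, the exchange property shows that \<open>v\<close> and
    \<open>y\<close> determine the same line.\<close>
  have through: "{y\<in>X. v \<in> line p y} = (if v \<in> ray p then X else line p v - ray p)" if "v \<in> D" for v
  proof (cases "v \<in> ray p")
    case True
    then show ?thesis using ray_subset_line by auto
  next
    case False
    have "v \<in> X" using that False by (simp add: D_def X_def)
    then have "line p v \<subseteq> H" by (rule lineH)
    then show ?thesis using False line_exchange by (auto simp: X_def)
  qed
  have card_through: "real (card {y\<in>X. v \<in> line p y}) = (r\<^sup>2 - r) + (if v \<in> ray p then r ^ 3 - r\<^sup>2 else 0)"
    if "v \<in> D" for v
  proof (cases "v \<in> ray p")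
    case False
    then have "v \<in> X" using that by (simp add: D_def X_def)
    then have "finite (line p v)" using lineH fin finite_subset by blast
    then have "card (line p v - ray p) = q\<^sup>2 - q" "q \<le> q\<^sup>2"
      using card_line[OF p0 False] card_ray[OF p0] ray_subset_line[of p v]
      by (simp_all add: card_Diff_subset finite_subset power2_eq_square)
    then show ?thesis using False by (simp add: through[OF that] of_nat_diff r_def)
  qed (simp add: through[OF that] cX)
  \<comment> \<open>Scaling by \<open>a\<close> multiplies \<open>Q\<close> by the square of an
    element of the small field, so every nonzero multiple of \<open>p\<close> still has its value in
    \<open>T\<close>.\<close>
  have "D \<inter> ray p = ray p - {0}"
  proof -
    have "Q (scl (\<iota> a) p) \<in> T" if "a \<noteq> 0" for a
    proof -
      have "Q (scl (\<iota> a) p) = \<iota> (a * a) * u" by (simp add: Q_scale p power2_eq_square)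
      then show ?thesis using T(2)[of "a * a"] u that by auto
    qed
    then show ?thesis using rayH T(1) p0 by (auto simp: D_def ray_def)
  qed
  then have cDp: "real (card (D \<inter> ray p)) = r - 1"
    using card_ray[OF p0] q_gt_1 image_eqI[of 0 "\<lambda>a. scl (\<iota> a) p" 0 UNIV]
    by (simp add: card_Diff_singleton ray_def of_nat_diff r_def)
  have "(r ^ 3 - r) * card T = (\<Sum>y\<in>X. real (card {v\<in>D. v \<in> line p y}))"
    by (simp add: lines cX)
  also have "\<dots> = (\<Sum>v\<in>D. real (card {y\<in>X. v \<in> line p y}))"
    using sum_card_swap[OF fin(1,2), of "\<lambda>y v. v \<in> line p y"] by (simp flip: of_nat_sum)
  also have "\<dots> = (r\<^sup>2 - r) * card D + (r ^ 3 - r\<^sup>2) * card (D \<inter> ray p)"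
    using fin by (simp add: card_through sum.distrib sum.If_cases Int_def)
  also have "real (card D) = (r + 1) * card T"
    using card_perp_point_preimage[OF n T p(1) p0] contr
    by (simp add: D_def H_def perp_def p r_def conj_ac)
  \<comment> \<open>With \<open>(r + 1) * card T\<close> for the size of \<open>D\<close>, the terms
    in \<open>card T\<close> cancel and only the surplus from the ray of \<open>p\<close>
    remains.\<close>
  finally have "(r ^ 3 - r\<^sup>2) * (r - 1) = 0"
    by (simp add: cDp algebra_simps power2_eq_square power3_eq_cube)
  then show False using r by (simp add: power2_eq_square power3_eq_cube)
qed

subsection \<open>Generators and ovoids\<close>

text \<open>A vector of \<open>perp G\<close> can be adjoined to an isotropic \<open>G\<close>
  without losing isotropy, since the form is alternating; maximality puts it into \<open>G\<close>.
  Conversely, an isotropic space containing \<open>G\<close> lies in \<open>perp G\<close>.\<close>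

lemma generators_iff:
  "G \<in> generators (\<lambda>c. scl (\<iota> c)) V \<beta> \<longleftrightarrow> F.subspace G \<and> G \<subseteq> V \<and> perp G = G"
proof
  assume "G \<in> generators (\<lambda>c. scl (\<iota> c)) V \<beta>"
  then have G: "F.subspace G" "G \<subseteq> V" and iso: "\<forall>x\<in>G. \<forall>y\<in>G. \<beta> x y = 0"
    and max: "\<And>S. totally_isotropic (\<lambda>c. scl (\<iota> c)) V \<beta> S \<Longrightarrow> G \<subseteq> S \<Longrightarrow> S = G"
    by (auto simp: generators_def totally_isotropic_def)
  have "v \<in> G" if v: "v \<in> perp G" for v
  proof -
    define S where "S = F.span (insert v G)"
    have S: "\<exists>a. x - scl (\<iota> a) v \<in> G" if "x \<in> S" for x
      using that F.span_breakdown_eq[of x v G] F.span_eq_iff[THEN iffD2, OF G(1)] by (simp add: S_def)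
    have "\<beta> x y = 0" if xy: "x \<in> S" "y \<in> S" for x y
    proof -
      obtain a b where ab: "x - scl (\<iota> a) v \<in> G" "y - scl (\<iota> b) v \<in> G"
        using S[OF xy(1)] S[OF xy(2)] by blast
      define u w where "u = x - scl (\<iota> a) v" and "w = y - scl (\<iota> b) v"
      have eq: "x = u + scl (\<iota> a) v" "y = w + scl (\<iota> b) v" by (simp_all add: u_def w_def)
      have "\<beta> v w = 0" "\<beta> v u = 0" "\<beta> u w = 0" using v iso ab by (auto simp: perp_def u_def w_def)
      moreover have "\<beta> u v = 0" using \<open>\<beta> v u = 0\<close> B_sym by metis
      ultimately show ?thesis by (simp add: eq B_linear tr_add tr_scale)
    qed
    moreover have "S \<subseteq> V"
      unfolding S_def using v G F_subspace[OF subspace_V] by (intro F.span_minimal) (auto simp: perp_def)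
    ultimately have "totally_isotropic (\<lambda>c. scl (\<iota> c)) V \<beta> S"
      by (simp add: totally_isotropic_def S_def F.subspace_span)
    moreover have "insert v G \<subseteq> S" unfolding S_def by (rule F.span_superset)
    ultimately show ?thesis using max[of S] by auto
  qed
  moreover have "G \<subseteq> perp G" using G iso by (auto simp: perp_def)
  ultimately show "F.subspace G \<and> G \<subseteq> V \<and> perp G = G" using G by blast
next
  assume G: "F.subspace G \<and> G \<subseteq> V \<and> perp G = G"
  have "S = G" if "totally_isotropic (\<lambda>c. scl (\<iota> c)) V \<beta> S" "G \<subseteq> S" for S
  proof -
    have "S \<subseteq> perp G" using that by (auto simp: totally_isotropic_def perp_def)
    then show ?thesis using G that(2) by auto
  qed
  moreover have "\<forall>x\<in>G. \<forall>y\<in>G. \<beta> x y = 0" using G by (auto simp: perp_def)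
  ultimately show "G \<in> generators (\<lambda>c. scl (\<iota> c)) V \<beta>"
    using G by (simp add: generators_def totally_isotropic_def)
qed

lemma perp_eq_self:
  assumes G: "F.subspace G" "G \<subseteq> V" "\<forall>x\<in>G. \<forall>y\<in>G. \<beta> x y = 0" and card: "card G = q ^ n"
  shows "perp G = G"
proof -
  have "q ^ n * card (perp G) = q ^ n * q ^ n"
    using card_perp[OF G(1,2)] by (simp add: card card_V mult_2 power_add)
  then have "card (perp G) = card G" using q_gt_1 card by simp
  moreover have "G \<subseteq> perp G" using G by (auto simp: perp_def)
  moreover have "finite (perp G)" by (rule subset_finite) (auto simp: perp_def)
  ultimately show ?thesis using card_subset_eq by metis
qed

lemma span_single: "F.span {v} = ray v"
  by (simp add: F.span_singleton ray_def)

text \<open>The map from a vector to the point it spans has fibres of size \<open>q - 1\<close>,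
  because all nonzero multiples of a vector with value in \<open>T\<close> have their values in
  \<open>T\<close>.\<close>

lemma card_points:
  assumes T: "T \<subseteq> - {0}" "\<And>c. c \<noteq> 0 \<Longrightarrow> (\<lambda>t. \<iota> c * t) ` T = T"
    and G: "F.subspace G" "G \<subseteq> V"
  shows "(q - 1) * card {P \<in> {F.span {v} | v. v \<in> V \<and> Q v \<in> T}. P \<subseteq> G} = card {v\<in>G. Q v \<in> T}"
proof -
  define X where "X = {v\<in>G. Q v \<in> T}"
  have finX: "finite X" using subset_finite[OF G(2)] by (simp add: X_def)
  have X0: "v \<noteq> 0" if "v \<in> X" for v using that T(1) by (auto simp: X_def)
  have self: "v \<in> ray v" for v using F.span_base[of v "{v}"] by (simp add: span_single)
  have ray_G: "ray v \<subseteq> G \<longleftrightarrow> v \<in> G" for v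
    using self scale_mem[OF G(1)] by (auto simp: ray_def)
  have fibre: "{v\<in>X. ray v = ray w} = ray w - {0}" if w: "w \<in> X" for w
  proof (intro equalityI subsetI)
    fix v assume "v \<in> {v\<in>X. ray v = ray w}"
    then show "v \<in> ray w - {0}" using self X0 by auto
  next
    fix v assume v: "v \<in> ray w - {0}"
    then obtain a where a: "v = scl (\<iota> a) w" "a \<noteq> 0" by (auto simp: ray_def)
    have wv: "w = scl (\<iota> (inverse a)) v" using a by (simp add: emb_inverse)
    have "v \<in> ray w" "w \<in> ray v" using v wv by (auto simp: ray_def)
    then have "ray v = ray w"
      unfolding span_single[symmetric] F.span_eq by (simp add: span_single)
    moreover have "Q v = \<iota> (a * a) * Q w" by (simp add: a Q_scale power2_eq_square)
    then have "Q v \<in> T" using T(2)[of "a * a"] w a by (auto simp: X_def)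
    moreover have "v \<in> G" using ray_G[of w] w v by (auto simp: X_def)
    ultimately show "v \<in> {v\<in>X. ray v = ray w}" by (simp add: X_def)
  qed
  have "card X = (\<Sum>P\<in>ray ` X. card {v\<in>X. ray v = P})"
    unfolding card_eq_sum by (rule sum.image_gen[OF finX])
  also have "\<dots> = (\<Sum>P\<in>ray ` X. q - 1)"
  proof (intro sum.cong[OF refl])
    fix P assume "P \<in> ray ` X"
    then obtain w where w: "w \<in> X" "P = ray w" by blast
    have "0 \<in> ray w" using F.span_zero[of "{w}"] by (simp add: span_single)
    then show "card {v\<in>X. ray v = P} = q - 1"
      using w X0[OF w(1)] by (simp add: fibre card_ray card_Diff_singleton)
  qed
  also have "\<dots> = (q - 1) * card (ray ` X)" by simp
  also have "ray ` X = {P \<in> {F.span {v} | v. v \<in> V \<and> Q v \<in> T}. P \<subseteq> G}"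
    using G(2) ray_G unfolding span_single by (auto simp: X_def)
  finally show ?thesis by (simp add: X_def)
qed

text \<open>Points are replaced by vectors, generators by self-perpendicular subspaces, and the
  intersection number is multiplied by \<open>q - 1\<close>.\<close>

lemma is_ovoid_iff:
  assumes T: "T \<subseteq> - {0}" "\<And>c. c \<noteq> 0 \<Longrightarrow> (\<lambda>t. \<iota> c * t) ` T = T"
  shows "is_ovoid (\<lambda>c. scl (\<iota> c)) V \<beta> m {F.span {v} | v. v \<in> V \<and> Q v \<in> T} \<longleftrightarrow>
    (\<forall>G. F.subspace G \<and> G \<subseteq> V \<and> perp G = G \<longrightarrow> card {v\<in>G. Q v \<in> T} = (q - 1) * m)"
    (is "is_ovoid _ _ _ _ ?M \<longleftrightarrow> _")
proof -
  have "?M \<subseteq> pg_points (\<lambda>c. scl (\<iota> c)) V"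
  proof
    fix P assume "P \<in> ?M"
    then obtain v where v: "P = F.span {v}" "v \<in> V" "Q v \<in> T" by blast
    then have "v \<noteq> 0" using T(1) by auto
    then have "F.dim P = 1"
      using v F.dim_eq_card_independent[of "{v}"] by (simp add: F.dim_span F.dependent_single)
    moreover have "P \<subseteq> V" unfolding v using v F_subspace[OF subspace_V] by (intro F.span_minimal) auto
    ultimately show "P \<in> pg_points (\<lambda>c. scl (\<iota> c)) V"
      by (simp add: pg_points_def v(1) F.subspace_span)
  qed
  moreover have "card {P\<in>?M. P \<subseteq> G} = m \<longleftrightarrow> card {v\<in>G. Q v \<in> T} = (q - 1) * m"
    if "F.subspace G" "G \<subseteq> V" for G
  proof -
    have "card {P\<in>?M. P \<subseteq> G} = m \<longleftrightarrow> (q - 1) * card {P\<in>?M. P \<subseteq> G} = (q - 1) * m"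
      using q_gt_1 by simp
    also have "(q - 1) * card {P\<in>?M. P \<subseteq> G} = card {v\<in>G. Q v \<in> T}"
      by (rule card_points[OF T that])
    finally show ?thesis .
  qed
  ultimately show ?thesis unfolding is_ovoid_def Ball_def generators_iff by blast
qed

end

subsection \<open>Coordinates\<close>

lemma card_fun_support:
  fixes I :: "'i set"
  assumes "finite I"
  shows "card {x :: 'i \<Rightarrow> 'a::{finite,zero}. \<forall>i. i \<notin> I \<longrightarrow> x i = 0} = CARD('a) ^ card I"
    and "finite {x :: 'i \<Rightarrow> 'a. \<forall>i. i \<notin> I \<longrightarrow> x i = 0}"
proof -
  let ?A = "{x :: 'i \<Rightarrow> 'a. \<forall>i. i \<notin> I \<longrightarrow> x i = 0}"
  have bij: "bij_betw (\<lambda>x. restrict x I) ?A (I \<rightarrow>\<^sub>E (UNIV :: 'a set))"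
    by (rule bij_betw_byWitness[where f' = "\<lambda>f i. if i \<in> I then f i else 0"]) (auto simp: fun_eq_iff PiE_def extensional_def)
  show "card ?A = CARD('a) ^ card I"
    using bij_betw_same_card[OF bij] assms by (simp add: card_PiE)
  show "finite ?A" using bij_betw_finite[OF bij] assms by (simp add: finite_PiE)
qed

lemma card_mult_eq:
  fixes s :: "'a::{finite,field}"
  shows "card {(a, b). a * b = s} = (CARD('a) - 1) + (if s = 0 then CARD('a) else 0)"
proof -
  have b: "card {b. a * b = s} = 1" if "a \<noteq> 0" for a
  proof -
    have "{b. a * b = s} = {s / a}" using that by (auto simp: field_simps)
    then show ?thesis by simp
  qed
  have "{(a, b). a * b = s} = (SIGMA a:UNIV. {b. a * b = s})" by auto
  then have "card {(a, b). a * b = s} = (\<Sum>a\<in>UNIV. card {b. a * b = s})" by simp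
  also have "\<dots> = card {b. 0 * b = s} + (\<Sum>a\<in>UNIV - {0}. card {b. a * b = s})"
    by (rule sum.remove) auto
  also have "(\<Sum>a\<in>UNIV - {0}. card {b. a * b = s}) = CARD('a) - 1"
    by (simp add: b card_Diff_singleton)
  finally show ?thesis by (cases "s = 0") auto
qed

text \<open>A root splits off a linear factor with a linear cofactor, and neither is a unit.\<close>

lemma irreducible_quadratic_no_root:
  fixes a0 a1 :: "'a::field"
  assumes "irreducible [:a1, a0, 1:]"
  shows "x\<^sup>2 + a0 * x + a1 \<noteq> 0"
proof
  assume "x\<^sup>2 + a0 * x + a1 = 0"
  then have "poly [:a1, a0, 1:] x = 0" by (simp add: algebra_simps power2_eq_square)
  then obtain p where p: "[:a1, a0, 1:] = [:- x, 1:] * p" by (metis poly_eq_0_iff_dvd dvdE)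
  then have "[:- x, 1:] dvd 1 \<or> p dvd 1" using assms irreducibleD by blast
  moreover have "p \<noteq> 0" using p by auto
  then have "degree [:a1, a0, 1:] = 1 + degree p"
    unfolding p by (subst degree_mult_eq) auto
  then have "degree p = 1" by simp
  ultimately show False using \<open>p \<noteq> 0\<close> by (auto simp: is_unit_iff_degree)
qed

locale elliptic_coordinates = quadratic_extension \<iota> q h
  for \<iota> :: "'k::finite_field \<Rightarrow> 'a::finite_field" and q h :: nat +
  fixes d :: nat and a0 a1 :: 'a
  assumes d: "even d" "d div 2 \<ge> 4" "even (d div 2)"
    and irreducible: "irreducible [:a1, a0, 1:]"
begin

abbreviation scl :: "'a \<Rightarrow> (nat \<Rightarrow> 'a) \<Rightarrow> nat \<Rightarrow> 'a" where
  "scl \<equiv> restr_scale (\<lambda>c. c)"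

definition n :: nat where "n = d div 2"
definition k :: nat where "k = d div 4"

lemma n_eq: "n = 2 * k" and k_ge_2: "k \<ge> 2" and n_div: "d div 2 = n" "d div 4 = k"
  using d unfolding n_def k_def by presburger+

text \<open>The first \<open>j\<close> hyperbolic pairs of coordinates are dropped:
  \<open>j = 0\<close> is the whole space and \<open>j = k - 1\<close> the anisotropic plane. The
  spaces between serve the induction that counts zeros.\<close>

definition tail_space :: "nat \<Rightarrow> (nat \<Rightarrow> 'a) set" where
  "tail_space j = {x. \<forall>i. i \<notin> {2 * j + 1..n} \<longrightarrow> x i = 0}"

abbreviation Q where "Q \<equiv> Q' d a0 a1"
abbreviation B where "B \<equiv> kappa' d a0 a1"

lemma tail_space_0: "tail_space 0 = coord_space d"
  by (simp add: tail_space_def coord_space_def n_div)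

lemma Q_eq: "Q x = (\<Sum>i=1..k - 1. x (2 * i - 1) * x (2 * i))
     + (x (n - 1))\<^sup>2 + a0 * x (n - 1) * x n + a1 * (x n)\<^sup>2"
  by (simp add: Q'_def n_div)

lemma two_eq_0: "2 * x = 0" for x :: 'a
  using add_self_eq_0[OF card_a', of x] by (metis mult_2)

lemma B_eq: "B x y = (\<Sum>i=1..k - 1. x (2 * i - 1) * y (2 * i) + x (2 * i) * y (2 * i - 1))
    + a0 * (x (n - 1) * y n + x n * y (n - 1))"
proof -
  have "B x y = (\<Sum>i=1..k - 1. x (2 * i - 1) * y (2 * i) + x (2 * i) * y (2 * i - 1))
    + a0 * (x (n - 1) * y n + x n * y (n - 1)) + 2 * (x (n - 1) * y (n - 1) + a1 * (x n * y n))"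
    unfolding kappa'_def Q_eq
    by (simp add: sum.distrib algebra_simps power2_eq_square)
  then show ?thesis by (simp only: two_eq_0) simp
qed

lemma Q_scale: "Q (scl c x) = c\<^sup>2 * Q x"
  by (simp add: Q_eq restr_scale_def sum_distrib_left algebra_simps power2_eq_square)

text \<open>Otherwise a square root of \<open>a1\<close> would be a root of the irreducible
  polynomial.\<close>

lemma a0_nonzero: "a0 \<noteq> 0"
proof
  assume "a0 = 0"
  obtain c where "c\<^sup>2 = a1" using bij_square[OF card_a'] by (metis bij_pointE)
  then have "c\<^sup>2 + a0 * c + a1 = 0" using \<open>a0 = 0\<close> add_self_eq_0[OF card_a', of a1] by simp
  then show False using irreducible_quadratic_no_root[OF irreducible] by blast
qed

lemma B_unit:
  assumes m: "m \<ge> 1" "m \<le> n"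
  shows "B (\<lambda>i. if i = m then 1 else 0) y =
    (if m = n then a0 * y (n - 1) else if m = n - 1 then a0 * y n
     else if even m then y (m - 1) else y (m + 1))"
proof -
  let ?e = "\<lambda>i. if i = m then 1 else 0 :: 'a"
  \<comment> \<open>This is the index of the coordinate pair that contains \<open>m\<close>.\<close>
  let ?i = "(m + 1) div 2"
  have "(\<Sum>i=1..k - 1. ?e (2 * i - 1) * y (2 * i) + ?e (2 * i) * y (2 * i - 1)) =
      (\<Sum>i=1..k - 1. if i = ?i then (if even m then y (m - 1) else y (m + 1)) else 0)"
  proof (rule sum.cong[OF refl])
    fix i assume "i \<in> {1..k - 1}"
    then have "2 * i - 1 = m \<longleftrightarrow> odd m \<and> i = ?i" "2 * i = m \<longleftrightarrow> even m \<and> i = ?i"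
      "odd m \<Longrightarrow> 2 * ?i = m + 1" "even m \<Longrightarrow> 2 * ?i - 1 = m - 1"
      by (simp_all, presburger+)
    then show "?e (2 * i - 1) * y (2 * i) + ?e (2 * i) * y (2 * i - 1) =
        (if i = ?i then (if even m then y (m - 1) else y (m + 1)) else 0)" by auto
  qed
  also have "\<dots> = (if m \<le> n - 2 then if even m then y (m - 1) else y (m + 1) else 0)"
  proof -
    have "?i \<in> {1..k - 1} \<longleftrightarrow> m \<le> n - 2" unfolding n_eq using m k_ge_2 by (simp, presburger)
    then show ?thesis by (simp add: sum.delta)
  qed
  moreover have "m \<le> n - 2 \<longleftrightarrow> m \<noteq> n \<and> m \<noteq> n - 1" "n - 1 \<noteq> n"
    using m n_eq k_ge_2 by linarith+
  ultimately show ?thesis unfolding B_eq by auto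
qed

lemma nondegenerate:
  assumes j: "j < k" and y: "y \<in> tail_space j" "y \<noteq> 0"
  shows "\<exists>x\<in>tail_space j. B x y \<noteq> 0"
proof -
  obtain m where "y m \<noteq> 0" using y(2) by (auto simp: fun_eq_iff)
  then have m: "y m \<noteq> 0" "2 * j + 1 \<le> m" "m \<le> n" using y(1) by (auto simp: tail_space_def)
  \<comment> \<open>The partner of \<open>m\<close> in its coordinate pair; pairing with its unit
    vector reads off \<open>y m\<close>. Pairs begin at odd indices and \<open>n\<close> is even, so
    \<open>m'\<close> stays in the same tail.\<close>
  define m' where "m' = (if even m then m - 1 else m + 1)"
  have m': "2 * j + 1 \<le> m'" "m' \<le> n" "m' = n \<longleftrightarrow> m = n - 1" "m' = n - 1 \<longleftrightarrow> m = n"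
    "even m' \<longleftrightarrow> odd m" "even m' \<Longrightarrow> m' - 1 = m" "odd m' \<Longrightarrow> m' + 1 = m"
    unfolding m'_def using m n_eq j by (auto, presburger+)
  define e where "e = (\<lambda>i. if i = m' then 1 else 0 :: 'a)"
  have "B e y = (if m = n \<or> m = n - 1 then a0 * y m else y m)"
    unfolding e_def using m' by (subst B_unit) auto
  moreover have "e \<in> tail_space j" using m' by (auto simp: e_def tail_space_def)
  ultimately show ?thesis using m a0_nonzero by (intro bexI[of _ e]) auto
qed

lemma finite_tail_space: "finite (tail_space j)"
  unfolding tail_space_def by (rule card_fun_support) simp

lemma card_tail_space: "card (tail_space j) = q ^ (2 * (n - 2 * j))"
  unfolding tail_space_def by (subst card_fun_support) (simp_all add: card_a power_mult)

text \<open>A zero with nonzero last coordinate would give, after division by it, a root of the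
  irreducible polynomial.\<close>

lemma card_zeros_last: "{x\<in>tail_space (k - 1). Q x = 0} = {0}"
proof -
  have "x = 0" if x: "x \<in> tail_space (k - 1)" "Q x = 0" for x
  proof -
    have zero: "x i = 0" if "i \<noteq> n - 1" "i \<noteq> n" for i
    proof -
      have "i \<notin> {2 * (k - 1) + 1..n}" unfolding n_eq using that n_eq k_ge_2 by (simp, presburger)
      then show ?thesis using x(1) unfolding tail_space_def by blast
    qed
    have "(\<Sum>i=1..k - 1. x (2 * i - 1) * x (2 * i)) = 0"
      by (intro sum.neutral ballI) (use zero n_eq k_ge_2 in auto)
    then have eq: "(x (n - 1))\<^sup>2 + a0 * x (n - 1) * x n + a1 * (x n)\<^sup>2 = 0" using x(2) by (simp add: Q_eq)
    have xn: "x n = 0"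
    proof (rule ccontr)
      assume "x n \<noteq> 0"
      then have "(x (n - 1) / x n)\<^sup>2 + a0 * (x (n - 1) / x n) + a1 =
          ((x (n - 1))\<^sup>2 + a0 * x (n - 1) * x n + a1 * (x n)\<^sup>2) / (x n)\<^sup>2"
        by (simp add: field_simps power2_eq_square)
      then show False using eq irreducible_quadratic_no_root[OF irreducible, of "x (n - 1) / x n"] by simp
    qed
    then have "x (n - 1) = 0" using eq by simp
    then show "x = 0" using xn zero by (metis ext zero_fun_apply)
  qed
  then show ?thesis by (auto simp: tail_space_def Q_eq)
qed

text \<open>Splitting off one hyperbolic pair \<open>(a, b)\<close> writes the form as
  \<open>a * b + Q x\<close> with \<open>x\<close> in the smaller tail, so for each \<open>x\<close>
  the solutions of \<open>a * b = - Q x\<close> are counted.\<close>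

lemma card_zeros_step:
  assumes j: "j + 1 < k"
  shows "card {x\<in>tail_space j. Q x = 0} =
    (q\<^sup>2 - 1) * card (tail_space (j + 1)) + q\<^sup>2 * card {x\<in>tail_space (j + 1). Q x = 0}"
proof -
  define f where "f = (\<lambda>(x :: nat \<Rightarrow> 'a, a, b). x(2 * j + 1 := a, 2 * j + 2 := b))"
  have Qf: "Q (f (x, a, b)) = a * b + Q x" if x: "x \<in> tail_space (j + 1)" for x a b
  proof -
    have x0: "x (2 * j + 1) = 0" "x (2 * j + 2) = 0" using x by (auto simp: tail_space_def)
    have "(\<Sum>i=1..k - 1. f (x, a, b) (2 * i - 1) * f (x, a, b) (2 * i)) =
        (\<Sum>i=1..k - 1. (if i = j + 1 then a * b else 0) + x (2 * i - 1) * x (2 * i))"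
      using x0 by (intro sum.cong[OF refl]) (auto simp: f_def)
    also have "\<dots> = a * b + (\<Sum>i=1..k - 1. x (2 * i - 1) * x (2 * i))"
      using j by (simp add: sum.distrib sum.delta)
    moreover have "f (x, a, b) (n - 1) = x (n - 1)" "f (x, a, b) n = x n"
      using j n_eq by (auto simp: f_def)
    ultimately show ?thesis by (simp add: Q_eq)
  qed
  let ?S = "SIGMA x:tail_space (j + 1). {(a, b). a * b = - Q x}"
  have "bij_betw f ?S {x\<in>tail_space j. Q x = 0}"
  proof (rule bij_betw_byWitness[where f' = "\<lambda>x. (x(2 * j + 1 := 0, 2 * j + 2 := 0), x (2 * j + 1), x (2 * j + 2))"])
    show "f ` ?S \<subseteq> {x\<in>tail_space j. Q x = 0}"
    proof clarify
      fix x a b assume x: "x \<in> tail_space (j + 1)" and ab: "a * b = - Q x"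
      have "f (x, a, b) \<in> tail_space j" using x j n_eq by (auto simp: f_def tail_space_def)
      then show "f (x, a, b) \<in> tail_space j \<and> Q (f (x, a, b)) = 0" using Qf[OF x] ab by simp
    qed
    have *: "x(2 * j + 1 := 0, 2 * j + 2 := 0) \<in> tail_space (j + 1)" if "x \<in> tail_space j" for x
      using that by (auto simp: tail_space_def)
    have **: "f (x(2 * j + 1 := 0, 2 * j + 2 := 0), x (2 * j + 1), x (2 * j + 2)) = x" for x
      by (auto simp: f_def fun_eq_iff)
    have "x (2 * j + 1) * x (2 * j + 2) = - Q (x(2 * j + 1 := 0, 2 * j + 2 := 0))"
      if "x \<in> tail_space j" "Q x = 0" for x
      using Qf[OF *[OF that(1)], of "x (2 * j + 1)" "x (2 * j + 2)"] that(2)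
      by (simp only: ** eq_neg_iff_add_eq_0)
    then show "(\<lambda>x. (x(2 * j + 1 := 0, 2 * j + 2 := 0), x (2 * j + 1), x (2 * j + 2))) `
        {x\<in>tail_space j. Q x = 0} \<subseteq> ?S"
      using * by auto
    show "\<forall>x\<in>{x\<in>tail_space j. Q x = 0}. f (x(2 * j + 1 := 0, 2 * j + 2 := 0), x (2 * j + 1), x (2 * j + 2)) = x"
      using ** by blast
  qed (auto simp: f_def fun_eq_iff tail_space_def)
  then have "card {x\<in>tail_space j. Q x = 0} = card ?S" by (rule bij_betw_same_card[symmetric])
  also have "\<dots> = (\<Sum>x\<in>tail_space (j + 1). card {(a, b). a * b = - Q x})"
    using finite_tail_space by simp
  also have "\<dots> = (\<Sum>x\<in>tail_space (j + 1). (q\<^sup>2 - 1) + (if Q x = 0 then q\<^sup>2 else 0))"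
    unfolding card_mult_eq card_a by simp
  also have "\<dots> = (q\<^sup>2 - 1) * card (tail_space (j + 1)) + q\<^sup>2 * card {x\<in>tail_space (j + 1). Q x = 0}"
    using finite_tail_space by (simp add: sum.distrib sum.If_cases Int_def mult.commute)
  finally show ?thesis .
qed

text \<open>The induction starts at the anisotropic plane and adds one hyperbolic pair at a time, so
  \<open>2 * i\<close> is the dimension over the large field.\<close>

lemma card_zeros:
  assumes "i \<ge> 1" "i \<le> k"
  shows "card {x\<in>tail_space (k - i). Q x = 0} + q ^ (2 * i) = q ^ (2 * (2 * i) - 2) + q ^ (2 * i - 2)"
  using assms
proof (induction i rule: dec_induct)
  case base
  then show ?case using card_zeros_last by simp
next
  case (step i)
  define z where "z = card {x\<in>tail_space (k - i). Q x = 0}"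
  have IH: "z + q ^ (2 * i) = q ^ (4 * i - 2) + q ^ (2 * i - 2)" using step by (simp add: z_def)
  have "k - Suc i + 1 = k - i" "n - 2 * (k - i) = 2 * i" using step n_eq by auto
  then have "card {x\<in>tail_space (k - Suc i). Q x = 0} = (q\<^sup>2 - 1) * q ^ (4 * i) + q\<^sup>2 * z"
    using card_zeros_step[of "k - Suc i"] step by (simp add: card_tail_space z_def)
  moreover have "(q\<^sup>2 - 1) * q ^ (4 * i) + q ^ (4 * i) = q\<^sup>2 * q ^ (4 * i)"
  proof -
    have "q\<^sup>2 = (q\<^sup>2 - 1) + 1" using q_gt_1 by simp
    then show ?thesis by (metis add_mult_distrib mult_1)
  qed
  moreover have "q\<^sup>2 * z + q\<^sup>2 * q ^ (2 * i) = q\<^sup>2 * q ^ (4 * i - 2) + q\<^sup>2 * q ^ (2 * i - 2)"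
    using IH by (metis distrib_left)
  moreover have "q\<^sup>2 * q ^ (4 * i - 2) = q ^ (4 * i)" "q\<^sup>2 * q ^ (2 * i - 2) = q ^ (2 * i)"
  proof -
    have "2 + (4 * i - 2) = 4 * i" "2 + (2 * i - 2) = 2 * i" using step by auto
    then show "q\<^sup>2 * q ^ (4 * i - 2) = q ^ (4 * i)" "q\<^sup>2 * q ^ (2 * i - 2) = q ^ (2 * i)"
      by (metis power_add)+
  qed
  moreover have "q ^ (2 * Suc i) = q\<^sup>2 * q ^ (2 * i)" "q ^ (2 * (2 * Suc i) - 2) = q\<^sup>2 * q ^ (4 * i)"
      "q ^ (2 * Suc i - 2) = q ^ (2 * i)"
    by (simp_all flip: power_add)
  \<comment> \<open>All powers are now expressed so that the claim is linear in the remaining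
    products.\<close>
  ultimately show ?case by linarith
qed

lemma quadratic_space_tail_space:
  assumes "i \<ge> 1" "i \<le> k"
  shows "quadratic_space \<iota> q h scl (tail_space (k - i)) Q B (2 * i)"
proof -
  interpret vector_space scl
    by (rule vector_space_restr_scale) (simp add: field_embedding_def)
  show ?thesis
  proof unfold_locales
    show "finite (tail_space (k - i))" by (rule finite_tail_space)
    show "subspace (tail_space (k - i))"
      by (rule subspaceI) (auto simp: tail_space_def restr_scale_def)
    show "Q (x + y) = Q x + Q y + B x y" for x y by (simp add: kappa'_def)
    show "Q (scl c x) = c\<^sup>2 * Q x" for c x by (rule Q_scale)
    show "B (x + y) z = B x z + B y z" for x y z
      by (simp add: B_eq sum.distrib algebra_simps)
    show "B (scl c x) y = c * B x y" for c x y
      by (simp add: B_eq restr_scale_def sum_distrib_left algebra_simps)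
    show "\<exists>x\<in>tail_space (k - i). B x y \<noteq> 0" if "y \<in> tail_space (k - i)" "y \<noteq> 0" for y
      by (rule nondegenerate) (use that assms in auto)
    show "2 * i \<ge> 2" using assms by simp
    have "n - 2 * (k - i) = 2 * i" using assms n_eq by simp
    then show "card (tail_space (k - i)) = q ^ (2 * (2 * i))" by (simp add: card_tail_space)
    show "card {v\<in>tail_space (k - i). Q v = 0} + q ^ (2 * i) = q ^ (2 * (2 * i) - 2) + q ^ (2 * i - 2)"
      by (rule card_zeros[OF assms])
  qed
qed

lemma restr_scale_eq: "restr_scale \<iota> = (\<lambda>c. scl (\<iota> c))"
  by (simp add: restr_scale_def fun_eq_iff)

section \<open>The totally singular subspace W and the generators W + L\<close>

definition head_space :: "(nat \<Rightarrow> 'a) set" where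
  "head_space = {x. \<forall>i. i \<notin> (\<lambda>i. 2 * i - 1) ` {1..k - 1} \<longrightarrow> x i = 0}"

text \<open>One coordinate is taken from each hyperbolic pair, so W has dimension
  \<open>k - 1\<close> over the large field.\<close>

lemma card_head_space: "card head_space = q ^ (n - 2)"
proof -
  have "card ((\<lambda>i. 2 * i - 1) ` {1..k - 1}) = k - 1"
    by (subst card_image) (auto simp: inj_on_def)
  moreover have "2 * (k - 1) = n - 2" using n_eq by simp
  ultimately show ?thesis
    unfolding head_space_def by (subst card_fun_support) (simp_all add: card_a flip: power_mult)
qed

lemma head_zero: "w \<in> head_space \<Longrightarrow> even i \<or> i > n - 2 \<Longrightarrow> w i = 0"
proof -
  assume w: "w \<in> head_space" and i: "even i \<or> i > n - 2"
  have "i \<noteq> 2 * j - 1" if "j \<in> {1..k - 1}" for j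
    using i that unfolding n_eq by (simp, presburger)
  then have "i \<notin> (\<lambda>i. 2 * i - 1) ` {1..k - 1}" by blast
  then show "w i = 0" using w by (simp add: head_space_def)
qed

lemma last_zero: "l \<in> tail_space (k - 1) \<Longrightarrow> i \<le> n - 2 \<Longrightarrow> l i = 0"
proof -
  assume l: "l \<in> tail_space (k - 1)" and i: "i \<le> n - 2"
  have "2 * (k - 1) = n - 2" using n_eq by simp
  then have "i \<notin> {2 * (k - 1) + 1..n}" using i by simp
  then show "l i = 0" using l unfolding tail_space_def by blast
qed

lemma add_head_space: "v \<in> head_space \<Longrightarrow> w \<in> head_space \<Longrightarrow> v + w \<in> head_space"
  by (auto simp: head_space_def)

text \<open>Each hyperbolic product contains an even coordinate, which vanishes on both summands,
  and the last two coordinates vanish on W. So W is totally singular and orthogonal to the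
  plane.\<close>

lemma Q_add_head:
  assumes w: "w \<in> head_space" and l: "l \<in> tail_space (k - 1)"
  shows "Q (w + l) = Q l"
proof -
  have "(w + l) (2 * i - 1) * (w + l) (2 * i) = 0" "l (2 * i - 1) * l (2 * i) = 0"
    if "i \<in> {1..k - 1}" for i
  proof -
    have "2 * i \<le> n - 2" using that n_eq by auto
    then show "(w + l) (2 * i - 1) * (w + l) (2 * i) = 0" "l (2 * i - 1) * l (2 * i) = 0"
      by (simp_all add: head_zero[OF w] last_zero[OF l])
  qed
  then have "(\<Sum>i=1..k - 1. (w + l) (2 * i - 1) * (w + l) (2 * i)) = 0"
    "(\<Sum>i=1..k - 1. l (2 * i - 1) * l (2 * i)) = 0"
    by (meson sum.neutral)+
  moreover have "w (n - 1) = 0" "w n = 0" using n_eq k_ge_2 by (auto intro!: head_zero[OF w])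
  ultimately show ?thesis unfolding Q_eq by simp
qed

lemma B_add_head:
  assumes "v \<in> head_space" "w \<in> head_space" "l \<in> tail_space (k - 1)" "m \<in> tail_space (k - 1)"
  shows "B (v + l) (w + m) = B l m"
proof -
  have "l + m \<in> tail_space (k - 1)" using assms by (auto simp: tail_space_def)
  then have "Q ((v + w) + (l + m)) = Q (l + m)" using assms by (intro Q_add_head add_head_space)
  moreover have "(v + w) + (l + m) = (v + l) + (w + m)" by (simp add: algebra_simps)
  ultimately show ?thesis using assms by (simp add: kappa'_def Q_add_head)
qed

lemma inj_on_add_head: "inj_on (\<lambda>(w, l). w + l) (head_space \<times> tail_space (k - 1))"
proof (rule inj_onI, clarify)
  fix v w :: "nat \<Rightarrow> 'a" and l m
  assume v: "v \<in> head_space" and w: "w \<in> head_space"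
    and l: "l \<in> tail_space (k - 1)" and m: "m \<in> tail_space (k - 1)" and eq: "v + l = w + m"
  have "v i = w i" for i
  proof (cases "i \<le> n - 2")
    case True
    then show ?thesis using fun_cong[OF eq, of i] by (simp add: last_zero[OF l] last_zero[OF m])
  next
    case False
    then show ?thesis by (simp add: head_zero[OF v] head_zero[OF w])
  qed
  then have "v = w" by (rule ext)
  then show "v = w \<and> l = m" using eq by simp
qed

text \<open>The whole space gives the backward direction. For the forward one, each isotropic line
  of the plane is enlarged by W to a generator, and dividing by the order of W gives the line
  hypothesis of \<open>plane_preimage_inverse_closed\<close>.\<close>

lemma is_ovoid_point_set_iff:
  assumes T: "T \<subseteq> - {0}" "\<And>c. c \<noteq> 0 \<Longrightarrow> (\<lambda>t. \<iota> c * t) ` T = T"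
  shows "is_ovoid (restr_scale \<iota>) (coord_space d) (kappa \<iota> d a0 a1)
      (card T div (q - 1) * q ^ (n - 2)) (point_set \<iota> d a0 a1 T) \<longleftrightarrow> inverse ` T = T"
proof -
  interpret V: quadratic_space \<iota> q h scl "tail_space 0" Q B n
    using quadratic_space_tail_space[of k] k_ge_2 by (simp add: n_eq)
  interpret E: quadratic_space \<iota> q h scl "tail_space (k - 1)" Q B 2
    using quadratic_space_tail_space[of 1] k_ge_2 by simp
  let ?G = "\<lambda>G. V.F.subspace G \<and> G \<subseteq> tail_space 0 \<and> V.perp G = G"
  have "kappa \<iota> d a0 a1 = V.\<beta>" by (simp add: kappa_def fun_eq_iff)
  moreover have "point_set \<iota> d a0 a1 T = {V.F.span {v} | v. v \<in> tail_space 0 \<and> Q v \<in> T}"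
    by (simp add: point_set_def tail_space_0 restr_scale_eq)
  moreover have "is_ovoid (\<lambda>c. scl (\<iota> c)) (tail_space 0) V.\<beta> m {V.F.span {v} | v. v \<in> tail_space 0 \<and> Q v \<in> T}
      \<longleftrightarrow> (\<forall>G. ?G G \<longrightarrow> card {v\<in>G. Q v \<in> T} = (q - 1) * m)" for m
    by (rule V.is_ovoid_iff[OF T])
  \<comment> \<open>The division is exact because \<open>T\<close> is a union of cosets of size
    \<open>q - 1\<close>.\<close>
  moreover have "(q - 1) * (card T div (q - 1) * q ^ (n - 2)) = card T * q ^ (n - 2)"
    using card_minus_one_dvd_card_invariant[OF emb T] by (simp add: card_k)
  ultimately have "is_ovoid (restr_scale \<iota>) (coord_space d) (kappa \<iota> d a0 a1)
      (card T div (q - 1) * q ^ (n - 2)) (point_set \<iota> d a0 a1 T) \<longleftrightarrow>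
      (\<forall>G. ?G G \<longrightarrow> card {v\<in>G. Q v \<in> T} = card T * q ^ (n - 2))"
    by (simp only: tail_space_0 restr_scale_eq)
  also have "\<dots> \<longleftrightarrow> inverse ` T = T"
  proof
    assume "inverse ` T = T"
    then show "\<forall>G. ?G G \<longrightarrow> card {v\<in>G. Q v \<in> T} = card T * q ^ (n - 2)"
      using V.card_self_perp_preimage T by blast
  next
    assume ovoid: "\<forall>G. ?G G \<longrightarrow> card {v\<in>G. Q v \<in> T} = card T * q ^ (n - 2)"
    have L: "card {v\<in>L. Q v \<in> T} = card T"
      if L: "V.F.subspace L" "L \<subseteq> tail_space (k - 1)" "card L = q\<^sup>2" "\<forall>x\<in>L. \<forall>y\<in>L. V.\<beta> x y = 0" for L
    proof -
      define f where "f = (\<lambda>(w, l). w + l :: nat \<Rightarrow> 'a)"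
      define G where "G = f ` (head_space \<times> L)"
      have inj: "inj_on f (head_space \<times> X)" if "X \<subseteq> L" for X
        unfolding f_def by (rule inj_on_subset[OF inj_on_add_head]) (use L(2) that in blast)
      have "V.F.subspace G"
      proof (rule V.F.subspaceI)
        have "0 \<in> head_space" by (simp add: head_space_def)
        then show "0 \<in> G" using V.F.subspace_0[OF L(1)] 
          unfolding G_def f_def by (intro image_eqI[of _ _ "(0, 0)"]) auto
      next
        fix x y assume "x \<in> G" "y \<in> G"
        then obtain v l w m where *: "v \<in> head_space" "l \<in> L" "w \<in> head_space" "m \<in> L"
          "x = v + l" "y = w + m" by (auto simp: G_def f_def)
        then have "x + y = f (v + w, l + m)" by (simp add: f_def algebra_simps)
        then show "x + y \<in> G"
          unfolding G_def using * add_head_space V.add_mem[OF L(1)] by blast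
      next
        fix c x assume "x \<in> G"
        then obtain v l where *: "v \<in> head_space" "l \<in> L" "x = v + l" by (auto simp: G_def f_def)
        then have "scl (\<iota> c) x = f (scl (\<iota> c) v, scl (\<iota> c) l)" by (simp add: f_def V.scale_right_distrib)
        moreover have "scl (\<iota> c) v \<in> head_space" using * by (auto simp: head_space_def restr_scale_def)
        ultimately show "scl (\<iota> c) x \<in> G" unfolding G_def using * V.scale_mem[OF L(1)] by blast
      qed
      moreover have "G \<subseteq> tail_space 0"
      proof -
        have "(\<lambda>i. 2 * i - 1) ` {1..k - 1} \<subseteq> {2 * 0 + 1..n}" using n_eq by auto
        then have "head_space \<subseteq> tail_space 0" unfolding head_space_def tail_space_def by blast
        moreover have "tail_space (k - 1) \<subseteq> tail_space 0" by (auto simp: tail_space_def)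
        ultimately show ?thesis
          using L(2) V.add_mem[OF V.F_subspace[OF V.subspace_V]] unfolding G_def f_def by fast
      qed
      moreover have "\<forall>x\<in>G. \<forall>y\<in>G. V.\<beta> x y = 0"
      proof (intro ballI)
        fix x y assume "x \<in> G" "y \<in> G"
        then obtain v l w m where *: "v \<in> head_space" "l \<in> L" "w \<in> head_space" "m \<in> L"
          "x = v + l" "y = w + m" by (auto simp: G_def f_def)
        then have "B x y = B l m" using L(2) by (auto intro!: B_add_head)
        then show "V.\<beta> x y = 0" using L(4) * by simp
      qed
      moreover have "card G = q ^ n"
      proof -
        have "n - 2 + 2 = n" using n_eq k_ge_2 by simp
        then have "q ^ (n - 2) * q\<^sup>2 = q ^ n" by (metis power_add)
        then show ?thesis
          unfolding G_def by (simp add: card_image[OF inj] card_cartesian_product card_head_space L(3))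
      qed
      \<comment> \<open>An isotropic subspace of order \<open>q ^ n\<close> is its own perpendicular
        space, so \<open>G\<close> is a generator.\<close>
      ultimately have "?G G" using V.perp_eq_self by blast
      then have "card {v\<in>G. Q v \<in> T} = card T * q ^ (n - 2)" using ovoid by blast
      moreover have "{v\<in>G. Q v \<in> T} = f ` (head_space \<times> {l\<in>L. Q l \<in> T})"
      proof -
        have "Q (f (w, l)) = Q l" if "w \<in> head_space" "l \<in> L" for w l
          using that L(2) Q_add_head by (auto simp: f_def)
        then show ?thesis unfolding G_def by auto
      qed
      moreover have "card (f ` (head_space \<times> {l\<in>L. Q l \<in> T})) = q ^ (n - 2) * card {l\<in>L. Q l \<in> T}"
        by (subst card_image[OF inj]) (auto simp: card_cartesian_product card_head_space)
      ultimately show ?thesis using q_gt_1 by simp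
    qed
    have inv: "inverse t \<in> T" if "t \<in> T" for t
      using E.plane_preimage_inverse_closed[OF refl T L that] by blast
    show "inverse ` T = T"
    proof
      show "T \<subseteq> inverse ` T" using inv by (metis image_eqI inverse_inverse_eq subsetI)
    qed (use inv in blast)
  qed
  finally show ?thesis .
qed

end

theorem theorem6p4:
  fixes \<iota> :: "'k::finite_field \<Rightarrow> 'a::finite_field"
    and q d :: nat and a0 a1 :: 'a and T :: "'a set"
  assumes "\<exists>h\<ge>1. q = 2 ^ h"
    and "CARD('k) = q" and "CARD('a) = q\<^sup>2"
    and "field_embedding \<iota>"
    and "even d" and "d div 2 \<ge> 4" and "even (d div 2)"
    and "irreducible [:a1, a0, 1:]"
    and "T \<subseteq> - {0}"
    and "\<And>c. c \<noteq> 0 \<Longrightarrow> (\<lambda>t. \<iota> c * t) ` T = T"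
  shows "is_ovoid (restr_scale \<iota>) (coord_space d) (kappa \<iota> d a0 a1)
           (card T div (q - 1) * q ^ (d div 2 - 2)) (point_set \<iota> d a0 a1 T)
         \<longleftrightarrow> T = {inverse x | x. x \<in> T}"
proof -
  obtain h where "q = 2 ^ h" using assms(1) by blast
  then interpret elliptic_coordinates \<iota> q h d a0 a1
    using assms by unfold_locales auto
  have "T = {inverse x | x. x \<in> T} \<longleftrightarrow> inverse ` T = T" by (auto simp: Setcompr_eq_image)
  then show ?thesis using is_ovoid_point_set_iff[OF assms(9,10)] by (simp add: n_def)
qed

end
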